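(* Fix all primitives of the model described in the context other than $s$ and $\rho$. For any social welfare function $W$ that is continuously differentiable, strictly increasing in every agent's utility (with partial derivatives bounded above and bounded away from zero) and (weakly) satisfies the Pigou-Dalton Principle, equilibrium social welfare is: (i) strictly decreasing in integration $\rho\in(0,1)$ if economic mobility is sufficiently close to $0$ (i.e. there is $s_0\in(0,1)$ such that for every $s\in(0,s_0)$ it is strictly decreasing in $\rho$ on $(0,1)$); and (ii) strictly increasing in integration $\rho\in(0,1)$ if economic mobility is sufficiently close to $1$ (i.e. there is $s_1\in(0,1)$ such that for every $s\in(s_1,1)$ it is strictly increasing in $\rho$ on $(0,1)$).
   Context: Agents and earning potential. $n$ is a positive integer divisible by $4$, $N=\{1,\dots,n\}$. Each agent $i$ has ability $a_i\in\{H,L\}$ and background $b_i\in\{R,P\}$. The classes are $Q=\{HR,LR,HP,LP\}$ (ability, background); each contains $n/4$ agents; $a_q,b_q$ denote the ability and background of class $q$. $s\in[0,1]$ is economic mobility. An agent in class $q=(a,b)$ has earning potential $y_q=y(a,b,s)\in\mathbb{R}$, continuous in $s\in[0,1]$ and differentiable on $(0,1)$, with: (1) $\frac{dy_{HP}}{ds}=-\frac{dy_{LR}}{ds}>0$ and $\frac{dy_{HR}}{ds}=\frac{dy_{LP}}{ds}=0$ on $(0,1)$; (2) for each $b$, $y(H,b,s)>y(L,b,s)$ for $s\in(0,1)$ and $\lim_{s\to0}[y(H,b,s)-y(L,b,s)]=0$; for each $a$, $y(a,R,s)>y(a,P,s)$ for $s\in(0,1)$ and $\lim_{s\to1}[y(a,R,s)-y(a,P,s)]=0$.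 Network. $G$ is an $n\times n$ matrix with $G_{ij}\ge0$, $G_{ii}=0$. There are $d>0$, $\omega\in(0,1)$, $\rho\in(0,1)$ ($\rho$ is called integration) such that for all classes $q,q'$ and all $i\in q$: $\sum_{j\in q'}G_{ij}=d\,g_{qq'}$, where $g_{qq'}=\omega$ if $q=q'$; $g_{qq'}=\rho(1-\omega)$ if $q\ne q'$ and $a_q=a_{q'}$; $g_{qq'}=(1-\rho)(1-\omega)$ if $q\neq q'$ and $b_q=b_{q'}$; $g_{qq'}=0$ otherwise. Changing $\rho$ means replacing $G$ by a matrix satisfying these conditions for the new $\rho$ with $d,\omega$ unchanged. Game. All agents simultaneously choose $x_i\in[0,\infty)$; payoffs are $U_i=u(x_i,y_i)-\sum_{j:\,x_i\le x_j}G_{ij}F(x_j-x_i)$. $F:[0,\infty)\to\mathbb{R}$ is smooth, strictly increasing and strictly convex with $F(0)=F'(0)=0$. $u:[0,\infty)\times Y\to\mathbb{R}$ ($Y$ an open interval containing all earning potentials $[y_{LP},y_{HR}]$) is twice continuously differentiable; subscripts on $u$ denote partial derivatives; $x^a(y):=\arg\max_{x\ge0}u(x,y)$. Assumption: for all $x\ge0$ and all $y\in Y$: (i) $u_{xx}(x,y)<0$ and $x^a(y)$ exists and is interior ($x^a(y)>0$); (ii) $u_y(x,y)>0$; (iii) $u_{xy}(x,y)>0$ for $x>0$; (iv) $V(y):=\max_{x\ge0}u(x,y)$ is strictly concave. Equilibrium. The solution concept is (pure) Nash equilibrium. The game has a unique Nash equilibrium, in which all agents of a class $q$ choose the same consumption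 $x_q^*$, depending on $G$ only through $d,\omega,\rho$; $U_i^*$ denotes agent $i$'s equilibrium payoff. Welfare. A social welfare function is a map $W:\mathbb{R}^n\to\mathbb{R}$ of $(U_1,\dots,U_n)$, evaluated at $(U_1^*,\dots,U_n^* )$. It satisfies the (weak) Pigou-Dalton Principle if $W$ weakly increases under any transfer of utility from an agent with higher utility to one with lower utility that does not reverse the ordering of their utilities: if $U_i>U_j$, $\varepsilon>0$ and $U_i-\varepsilon\ge U_j+\varepsilon$, then replacing $(U_i,U_j)$ by $(U_i-\varepsilon,U_j+\varepsilon)$ does not decrease $W$. "Partial derivatives bounded above and bounded away from zero" means there are $0<\underline m\le\overline m<\infty$ with $\underline m\le\partial W/\partial U_i\le\overline m$ for all $i$ everywhere. *)

theory Defs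
  imports "HOL-Analysis.Analysis"
begin

section \<open>Classes and earning potential\<close>

datatype ability = High | Low
datatype background = Rich | Poor

type_synonym agent_class = "ability \<times> background"

text \<open>The agents are the elements of a finite type \<open>'n\<close>, so \<open>n = CARD('n)\<close>. All classes having size
  \<open>n / 4\<close> forces \<open>n\<close> to be divisible by 4.\<close>

definition equal_classes :: "('n::finite \<Rightarrow> agent_class) \<Rightarrow> bool" where
  "equal_classes cls \<longleftrightarrow> (\<forall>q. 4 * card {i. cls i = q} = CARD('n))"

definition earning_potential :: "(ability \<Rightarrow> background \<Rightarrow> real \<Rightarrow> real) \<Rightarrow> bool" where
  "earning_potential y \<longleftrightarrow>
     (\<forall>a b. continuous_on {0..1} (y a b)) \<and>
     (\<forall>a b. \<forall>s\<in>{0<..<1}. y a b differentiable (at s)) \<and>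
     (\<forall>s\<in>{0<..<1}. deriv (y High Poor) s = - deriv (y Low Rich) s \<and> 0 < deriv (y High Poor) s \<and>
        deriv (y High Rich) s = 0 \<and> deriv (y Low Poor) s = 0) \<and>
     (\<forall>b. (\<forall>s\<in>{0<..<1}. y Low b s < y High b s) \<and>
        ((\<lambda>s. y High b s - y Low b s) \<longlongrightarrow> 0) (at_right 0)) \<and>
     (\<forall>a. (\<forall>s\<in>{0<..<1}. y a Poor s < y a Rich s) \<and>
        ((\<lambda>s. y a Rich s - y a Poor s) \<longlongrightarrow> 0) (at_left 1))"

section \<open>Network\<close>

definition link_share :: "real \<Rightarrow> real \<Rightarrow> agent_class \<Rightarrow> agent_class \<Rightarrow> real" where
  "link_share \<omega> \<rho> q q' =
     (if q = q' then \<omega>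
      else if fst q = fst q' then \<rho> * (1 - \<omega>)
      else if snd q = snd q' then (1 - \<rho>) * (1 - \<omega>)
      else 0)"

definition network ::
  "('n::finite \<Rightarrow> agent_class) \<Rightarrow> real \<Rightarrow> real \<Rightarrow> real \<Rightarrow> real^'n^'n \<Rightarrow> bool" where
  "network cls d \<omega> \<rho> G \<longleftrightarrow>
     (\<forall>i j. 0 \<le> G $ i $ j) \<and> (\<forall>i. G $ i $ i = 0) \<and>
     (\<forall>i q'. (\<Sum>j | cls j = q'. G $ i $ j) = d * link_share \<omega> \<rho> (cls i) q')"

section \<open>Consumption utility and comparison loss\<close>

text \<open>Partial derivatives of a function on \<open>{0..} \<times> Y\<close> with \<open>Y\<close> open: at \<open>x = 0\<close> the derivative in the
  first variable is one-sided.\<close>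

definition partial_x :: "(real \<Rightarrow> real \<Rightarrow> real) \<Rightarrow> real \<Rightarrow> real \<Rightarrow> real" where
  "partial_x f x y = vector_derivative (\<lambda>t. f t y) (at x within {0..})"

definition partial_y :: "(real \<Rightarrow> real \<Rightarrow> real) \<Rightarrow> real \<Rightarrow> real \<Rightarrow> real" where
  "partial_y f x y = deriv (f x) y"

definition C1_strip :: "real set \<Rightarrow> (real \<Rightarrow> real \<Rightarrow> real) \<Rightarrow> bool" where
  "C1_strip Y f \<longleftrightarrow>
     (\<forall>x\<ge>0. \<forall>y\<in>Y. (\<lambda>t. f t y) differentiable (at x within {0..}) \<and> f x differentiable (at y)) \<and>
     continuous_on ({0..} \<times> Y) (\<lambda>(x, y). partial_x f x y) \<and>
     continuous_on ({0..} \<times> Y) (\<lambda>(x, y). partial_y f x y)"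

definition C2_strip :: "real set \<Rightarrow> (real \<Rightarrow> real \<Rightarrow> real) \<Rightarrow> bool" where
  "C2_strip Y f \<longleftrightarrow> C1_strip Y f \<and> C1_strip Y (partial_x f) \<and> C1_strip Y (partial_y f)"

definition autarky_choice :: "(real \<Rightarrow> real \<Rightarrow> real) \<Rightarrow> real \<Rightarrow> real" where
  "autarky_choice u y = arg_max (\<lambda>x. u x y) (\<lambda>x. 0 \<le> x)"

definition strictly_convex_on :: "real set \<Rightarrow> (real \<Rightarrow> real) \<Rightarrow> bool" where
  "strictly_convex_on S f \<longleftrightarrow>
     (\<forall>x\<in>S. \<forall>z\<in>S. \<forall>t\<in>{0<..<1}. x \<noteq> z \<longrightarrow>
        f ((1 - t) * x + t * z) < (1 - t) * f x + t * f z)"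

definition consumption_utility :: "real set \<Rightarrow> (real \<Rightarrow> real \<Rightarrow> real) \<Rightarrow> bool" where
  "consumption_utility Y u \<longleftrightarrow>
     C2_strip Y u \<and>
     (\<forall>x\<ge>0. \<forall>y\<in>Y. partial_x (partial_x u) x y < 0) \<and>
     (\<forall>y\<in>Y. (\<exists>x. is_arg_max (\<lambda>x. u x y) (\<lambda>x. 0 \<le> x) x) \<and> 0 < autarky_choice u y) \<and>
     (\<forall>x\<ge>0. \<forall>y\<in>Y. 0 < partial_y u x y) \<and>
     (\<forall>x>0. \<forall>y\<in>Y. 0 < partial_y (partial_x u) x y) \<and>
     strictly_convex_on Y (\<lambda>y. - u (autarky_choice u y) y)"

text \<open>Smoothness on the closed half-line, with one-sided derivatives of all orders at 0.\<close>

definition smooth_half_line :: "(real \<Rightarrow> real) \<Rightarrow> bool" where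
  "smooth_half_line F \<longleftrightarrow>
     (\<exists>D :: nat \<Rightarrow> real \<Rightarrow> real.
        (\<forall>x\<ge>0. D 0 x = F x) \<and>
        (\<forall>k. \<forall>x\<ge>0. (D k has_real_derivative D (Suc k) x) (at x within {0..})))"

definition comparison_loss :: "(real \<Rightarrow> real) \<Rightarrow> bool" where
  "comparison_loss F \<longleftrightarrow>
     smooth_half_line F \<and> strict_mono_on {0..} F \<and> strictly_convex_on {0..} F \<and>
     F 0 = 0 \<and> (F has_real_derivative 0) (at 0 within {0..})"

section \<open>Game and equilibrium\<close>

text \<open>In the following, \<open>e i\<close> is the earning potential of agent \<open>i\<close> and \<open>x\<close> is a consumption profile.\<close>

definition payoff ::
  "(real \<Rightarrow> real \<Rightarrow> real) \<Rightarrow> (real \<Rightarrow> real) \<Rightarrow> ('n::finite \<Rightarrow> real) \<Rightarrow> real^'n^'n \<Rightarrow> real^'n \<Rightarrow> 'n \<Rightarrow> real"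
  where
  "payoff u F e G x i = u (x $ i) (e i) - (\<Sum>j | x $ i \<le> x $ j. G $ i $ j * F (x $ j - x $ i))"

definition nash_equilibrium ::
  "(real \<Rightarrow> real \<Rightarrow> real) \<Rightarrow> (real \<Rightarrow> real) \<Rightarrow> ('n::finite \<Rightarrow> real) \<Rightarrow> real^'n^'n \<Rightarrow> real^'n \<Rightarrow> bool"
  where
  "nash_equilibrium u F e G x \<longleftrightarrow>
     (\<forall>i. 0 \<le> x $ i) \<and>
     (\<forall>i. \<forall>z\<ge>0. payoff u F e G (\<chi> j. if j = i then z else x $ j) i \<le> payoff u F e G x i)"

definition equilibrium_payoffs ::
  "(real \<Rightarrow> real \<Rightarrow> real) \<Rightarrow> (real \<Rightarrow> real) \<Rightarrow> ('n::finite \<Rightarrow> real) \<Rightarrow> real^'n^'n \<Rightarrow> real^'n"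
  where
  "equilibrium_payoffs u F e G = (\<chi> i. payoff u F e G (THE x. nash_equilibrium u F e G x) i)"

definition equilibrium_welfare ::
  "(real^'n \<Rightarrow> real) \<Rightarrow> (real \<Rightarrow> real \<Rightarrow> real) \<Rightarrow> (real \<Rightarrow> real) \<Rightarrow>
   (ability \<Rightarrow> background \<Rightarrow> real \<Rightarrow> real) \<Rightarrow> ('n::finite \<Rightarrow> agent_class) \<Rightarrow> real \<Rightarrow> real^'n^'n \<Rightarrow> real"
  where
  "equilibrium_welfare W u F y cls s G =
     W (equilibrium_payoffs u F (\<lambda>i. y (fst (cls i)) (snd (cls i)) s) G)"

section \<open>Social welfare functions\<close>

definition partial_W :: "(real^'n \<Rightarrow> real) \<Rightarrow> 'n::finite \<Rightarrow> real^'n \<Rightarrow> real" where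
  "partial_W W i U = frechet_derivative W (at U) (axis i 1)"

definition C1_welfare :: "(real^'n::finite \<Rightarrow> real) \<Rightarrow> bool" where
  "C1_welfare W \<longleftrightarrow> (\<forall>U. W differentiable (at U)) \<and> (\<forall>i. continuous_on UNIV (partial_W W i))"

definition strictly_increasing_welfare :: "(real^'n::finite \<Rightarrow> real) \<Rightarrow> bool" where
  "strictly_increasing_welfare W \<longleftrightarrow> (\<forall>U i. \<forall>\<epsilon>>0. W U < W (U + \<epsilon> *\<^sub>R axis i 1))"

definition bounded_partials :: "(real^'n::finite \<Rightarrow> real) \<Rightarrow> bool" where
  "bounded_partials W \<longleftrightarrow>
     (\<exists>m M. 0 < m \<and> m \<le> M \<and> (\<forall>i U. m \<le> partial_W W i U \<and> partial_W W i U \<le> M))"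

definition weak_pigou_dalton :: "(real^'n::finite \<Rightarrow> real) \<Rightarrow> bool" where
  "weak_pigou_dalton W \<longleftrightarrow>
     (\<forall>U i j. \<forall>\<epsilon>>0. U $ i > U $ j \<and> U $ i - \<epsilon> \<ge> U $ j + \<epsilon> \<longrightarrow>
        W U \<le> W (U - \<epsilon> *\<^sub>R axis i 1 + \<epsilon> *\<^sub>R axis j 1))"

end

theory Submission
  imports Defs
begin

text \<open>The top class HR compares upwards to nobody and chooses its autarky consumption; HP and LR lose
  only from comparison to HR, and LP only from comparison to HP and LR. When mobility is close to
  0, LR almost coincides with HR while HP stays away from it, so HP faces a loss bounded away from 0
  whose weight grows with \<open>\<rho>\<close>. By revealed preference, raising \<open>\<rho>\<close> by \<open>h\<close> lowers the payoff of HP by at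
  least \<open>\<eta> h\<close>, with \<open>\<eta> > 0\<close> independent of \<open>s\<close>. The gain of LR is at most \<open>\<epsilon> h\<close>, as is that of LP:
  its links move to LR, who consumes more than HP, and the consumption of LR falls by at most \<open>\<epsilon> h\<close> since
  its comparison gap is small and \<open>F'(0) = 0\<close>. Because the partial derivatives of welfare are bounded
  and bounded away from 0, the loss of HP dominates. Swapping HP with LR and \<open>\<rho>\<close> with \<open>1 - \<rho>\<close> leaves the
  model invariant and turns mobility close to 1 into the same situation.\<close>

section \<open>Extending the comparison loss to the whole real line\<close>

lemma strictly_convex_on_imp_convex_on:
  assumes "strictly_convex_on S f" and "convex S"
  shows "convex_on S f"
proof (rule convex_onI)
  fix t x z :: real assume *: "0 < t" "t < 1" "x \<in> S" "z \<in> S"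
  show "f ((1 - t) *\<^sub>R x + t *\<^sub>R z) \<le> (1 - t) * f x + t * f z"
  proof (cases "x = z")
    case True
    then show ?thesis by (simp add: algebra_simps)
  next
    case False
    then show ?thesis
      using assms(1) * by (auto simp: strictly_convex_on_def intro: less_imp_le)
  qed
qed (fact assms(2))

text \<open>Because \<open>F\<close> and its one-sided derivative vanish at 0, extending
  \<open>F\<close> by zero to negative gaps gives a convex C1 function. Downward comparisons then
  cost nothing automatically, and the sign of a gap needs no case distinction later.\<close>

lemma comparison_loss_extension:
  assumes "comparison_loss F"
  obtains \<phi> where "\<And>t. ((\<lambda>t. F (max 0 t)) has_real_derivative \<phi> t) (at t)"
    and "continuous_on UNIV \<phi>" and "\<phi> 0 = 0" and "convex_on UNIV (\<lambda>t. F (max 0 t))"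
proof -
  from assms obtain D :: "nat \<Rightarrow> real \<Rightarrow> real" where D0: "\<And>x. 0 \<le> x \<Longrightarrow> D 0 x = F x"
    and D: "\<And>k x. 0 \<le> x \<Longrightarrow> (D k has_real_derivative D (Suc k) x) (at x within {0..})"
    unfolding comparison_loss_def smooth_half_line_def by blast
  have F0: "F 0 = 0" and smono: "strict_mono_on {0..} F" and scv: "strictly_convex_on {0..} F"
    and F'0: "(F has_real_derivative 0) (at 0 within {0..})"
    using assms by (auto simp: comparison_loss_def)
  define \<phi> where "\<phi> t = D 1 (max 0 t)" for t
  have derF: "(F has_real_derivative D 1 x) (at x within {0..})" if "0 \<le> x" for x
    using D[OF that, of 0] that
    by (intro has_field_derivative_transform_within[of "D 0" _ _ _ 1 F]) (auto simp: D0)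
  have "D 1 0 = 0"
  proof (rule vector_derivative_unique_within)
    show "at (0::real) within {0..} \<noteq> bot"
      by (simp add: at_within_Ici_at_right)
  qed (use derF[of 0] F'0 in \<open>simp_all add: has_real_derivative_iff_has_vector_derivative\<close>)
  then have \<phi>0: "\<phi> 0 = 0"
    by (simp add: \<phi>_def)
  have "((\<lambda>t. F (max 0 t)) has_real_derivative \<phi> t) (at t)" for t
  proof -
    \<comment> \<open>The two pieces are glued at 0, where both values and both one-sided
      derivatives are 0.\<close>
    have "((\<lambda>x. if x \<in> {0..} then F x else 0) has_vector_derivative
       (if t \<in> {0..} then D 1 t else 0)) (at t within UNIV)"
    proof (rule has_vector_derivative_If_within_closures[where T = "{..0}"])
      show "(F has_vector_derivative D 1 t) (at t within {0..} \<union> closure {0..} \<inter> closure {..0})"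
        if "t \<in> {0..} \<union> closure {0..} \<inter> closure {..0}"
      proof -
        have "{0..} \<union> closure {0..} \<inter> closure {..0} = {0::real..}" "0 \<le> t"
          using that by auto
        then show ?thesis
          using derF[of t] by (simp add: has_real_derivative_iff_has_vector_derivative)
      qed
    qed (use F0 \<open>D 1 0 = 0\<close> in auto)
    moreover have "(\<lambda>x. if x \<in> {0..} then F x else 0) = (\<lambda>t. F (max 0 t))"
      using F0 by (auto simp: max_def fun_eq_iff)
    moreover have "(if t \<in> {0..} then D 1 t else 0) = \<phi> t"
      using \<open>D 1 0 = 0\<close> by (auto simp: \<phi>_def max_def)
    ultimately show ?thesis
      by (simp add: has_real_derivative_iff_has_vector_derivative)
  qed
  moreover have "continuous_on UNIV \<phi>"
  proof -
    have "continuous_on {0..} (D 1)"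
      using D[of _ 1] by (intro DERIV_continuous_on) auto
    then show ?thesis
      unfolding \<phi>_def by (rule continuous_on_compose2) (auto intro!: continuous_intros)
  qed
  moreover have "convex_on UNIV (\<lambda>t. F (max 0 t))"
  proof (rule convex_onI)
    fix t x z :: real assume t: "0 < t" "t < 1"
    \<comment> \<open>The convex combination of the positive parts dominates the positive part of
      the convex combination, so monotonicity of \<open>F\<close> reduces the claim to convexity on
      the half-line.\<close>
    define v where "v = (1 - t) * max 0 x + t * max 0 z"
    have "(1 - t) * x + t * z \<le> v"
      unfolding v_def using t by (intro add_mono mult_left_mono) auto
    moreover have "0 \<le> v"
      unfolding v_def using t by auto
    ultimately have "F (max 0 ((1 - t) * x + t * z)) \<le> F v"
      using strict_mono_on_leD[OF smono, of "max 0 ((1 - t) * x + t * z)" v] by simp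
    also have "\<dots> \<le> (1 - t) * F (max 0 x) + t * F (max 0 z)"
      using convex_onD[OF strictly_convex_on_imp_convex_on[OF scv], of t "max 0 x" "max 0 z"] t
      by (simp add: v_def convex_real_interval)
    finally show "F (max 0 ((1 - t) *\<^sub>R x + t *\<^sub>R z)) \<le> (1 - t) * F (max 0 x) + t * F (max 0 z)"
      by simp
  qed auto
  ultimately show thesis
    using that \<phi>0 by blast
qed

lemma mvt_half_line:
  fixes f :: "real \<Rightarrow> real"
  assumes "\<And>x. 0 \<le> x \<Longrightarrow> (f has_real_derivative f' x) (at x within {0..})"
    and "0 \<le> a" and "a < b"
  obtains x where "a < x" "x < b" "f b - f a = f' x * (b - a)"
proof -
  have "\<exists>x\<in>{a<..<b}. f b - f a = (\<lambda>h. f' x * h) (b - a)"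
  proof (rule mvt_simple[OF assms(3)])
    fix x assume "a \<le> x" "x \<le> b"
    then show "(f has_derivative (*) (f' x)) (at x within {a..b})"
      using assms(1)[of x] \<open>0 \<le> a\<close>
      by (auto simp: has_field_derivative_def intro: has_derivative_subset)
  qed
  then show thesis
    using that by auto
qed

section \<open>Sums over agents grouped by class\<close>

abbreviation HR :: agent_class where "HR \<equiv> (High, Rich)"
abbreviation HP :: agent_class where "HP \<equiv> (High, Poor)"
abbreviation LR :: agent_class where "LR \<equiv> (Low, Rich)"
abbreviation LP :: agent_class where "LP \<equiv> (Low, Poor)"

lemma agent_class_cases:
  obtains "q = HR" | "q = HP" | "q = LR" | "q = LP"
proof (cases q)
  case (Pair a b)
  with that show thesis
    by (cases a; cases b) auto
qed

lemma sum_by_class: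
  fixes cls :: "'n::finite \<Rightarrow> agent_class"
  shows "(\<Sum>i\<in>UNIV. g i) = (\<Sum>q\<in>{HR, HP, LR, LP}. \<Sum>i | cls i = q. g i)"
proof -
  have "range cls \<subseteq> {HR, HP, LR, LP}"
    using agent_class_cases by blast
  from sum.group[OF _ _ this, of g] show ?thesis by simp
qed

text \<open>A function of the class is constant on each block of row \<open>i\<close>, so the sum
  depends on \<open>G\<close> only through the prescribed class totals.\<close>

lemma network_sum:
  assumes "network cls d \<omega> \<rho> G"
  shows "(\<Sum>j\<in>UNIV. G $ i $ j * f (cls j)) = (\<Sum>q\<in>{HR, HP, LR, LP}. d * link_share \<omega> \<rho> (cls i) q * f q)"
proof -
  have "(\<Sum>j | cls j = q. G $ i $ j * f (cls j)) = d * link_share \<omega> \<rho> (cls i) q * f q" for q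
  proof -
    have "(\<Sum>j | cls j = q. G $ i $ j) = d * link_share \<omega> \<rho> (cls i) q"
      using assms unfolding network_def by blast
    then show ?thesis
      by (simp flip: sum_distrib_right)
  qed
  then show ?thesis
    by (subst sum_by_class[where cls = cls]) simp
qed

section \<open>Effect of payoff changes on welfare\<close>

text \<open>Mean value theorem along the segment from \<open>U\<close> to \<open>U'\<close>: a
  single intermediate point \<open>V\<close> serves all agents, and linearity splits the derivative
  there into partial derivatives.\<close>

lemma welfare_mean_value:
  fixes W :: "real^'n::finite \<Rightarrow> real"
  assumes "C1_welfare W"
  obtains V where "W U' - W U = (\<Sum>i\<in>UNIV. partial_W W i V * (U' $ i - U $ i))"
proof -
  let ?D = "\<lambda>V. frechet_derivative W (at V)"
  have D: "(W has_derivative ?D V) (at V)" for V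
    using assms by (simp add: C1_welfare_def frechet_derivative_works)
  define \<gamma> where "\<gamma> t = U + t *\<^sub>R (U' - U)" for t :: real
  have "((\<lambda>t. W (\<gamma> t)) has_derivative (\<lambda>h. ?D (\<gamma> t) (h *\<^sub>R (U' - U)))) (at t within {0..1})" for t
    unfolding \<gamma>_def
    by (rule has_derivative_compose[OF _ D]) (auto intro!: derivative_eq_intros)
  then obtain t where "W (\<gamma> 1) - W (\<gamma> 0) = ?D (\<gamma> t) ((1 - 0) *\<^sub>R (U' - U))"
    using mvt_simple[of 0 1 "\<lambda>t. W (\<gamma> t)" "\<lambda>t h. ?D (\<gamma> t) (h *\<^sub>R (U' - U))"] by auto
  then have "W U' - W U = ?D (\<gamma> t) (U' - U)"
    by (simp add: \<gamma>_def)
  also have "\<dots> = ?D (\<gamma> t) (\<Sum>i\<in>UNIV. (U' - U) $ i *\<^sub>R axis i 1)"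
    using basis_expansion[of "U' - U"] by (simp add: scalar_mult_eq_scaleR)
  also have "\<dots> = (\<Sum>i\<in>UNIV. partial_W W i (\<gamma> t) * (U' $ i - U $ i))"
    using has_derivative_linear[OF D[of "\<gamma> t"]]
    by (simp add: linear_sum linear_cmul partial_W_def mult.commute)
  finally show thesis by (rule that)
qed

text \<open>Each agent of HP contributes at most \<open>- m * b\<close>, each agent of LR or LP at
  most \<open>M * a\<close>. The classes are equally large, so the sign of
  \<open>2 * M * a - m * b\<close> decides; the 2 counts the two classes that may gain.\<close>

lemma welfare_decreases:
  fixes W :: "real^'n::finite \<Rightarrow> real"
  assumes W: "C1_welfare W" and cls: "equal_classes cls"
    and m: "0 < m" "\<And>i U. m \<le> partial_W W i U" "\<And>i U. partial_W W i U \<le> M"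
    and pos: "0 \<le> a" "2 * M * a < m * b"
    and HR: "\<And>i. cls i = HR \<Longrightarrow> U' $ i = U $ i"
    and HP: "\<And>i. cls i = HP \<Longrightarrow> U' $ i \<le> U $ i - b"
    and low: "\<And>i. cls i = LR \<or> cls i = LP \<Longrightarrow> U' $ i \<le> U $ i + a"
  shows "W U' < W U"
proof -
  obtain V where V: "W U' - W U = (\<Sum>i\<in>UNIV. partial_W W i V * (U' $ i - U $ i))"
    using welfare_mean_value[OF W] by blast
  have "m \<le> M"
    using m(2,3) order_trans by blast
  have "0 \<le> 2 * M * a"
    using pos(1) m(1) \<open>m \<le> M\<close> by simp
  then have "0 < m * b"
    using pos(2) by linarith
  then have "0 < b"
    using m(1) by (simp add: zero_less_mult_iff)
  define f where "f q = (if q = HR then 0 else if q = HP then - m * b else M * a)" for q :: agent_class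
  have "partial_W W i V * (U' $ i - U $ i) \<le> f (cls i)" for i
  proof (rule agent_class_cases[of "cls i"])
    assume "cls i = HP"
    then have "partial_W W i V * (U' $ i - U $ i) \<le> partial_W W i V * - b"
      using HP[of i] m(1) m(2)[of i V] by (intro mult_left_mono) auto
    also have "\<dots> \<le> m * - b"
      using m(2)[of i V] \<open>0 < b\<close> by (intro mult_right_mono_neg) auto
    finally show ?thesis
      using \<open>cls i = HP\<close> by (simp add: f_def)
  next
    have *: ?thesis if "cls i = LR \<or> cls i = LP"
    proof -
      have "partial_W W i V * (U' $ i - U $ i) \<le> partial_W W i V * a"
        using low[of i] that m(1) m(2)[of i V] by (intro mult_left_mono) auto
      also have "\<dots> \<le> M * a"
        using m(3)[of i V] \<open>0 \<le> a\<close> by (intro mult_right_mono) auto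
      finally show ?thesis
        using that by (auto simp: f_def)
    qed
    show "cls i = LR \<Longrightarrow> ?thesis" "cls i = LP \<Longrightarrow> ?thesis"
      using * by auto
  qed (use HR[of i] in \<open>simp add: f_def\<close>)
  then have "W U' - W U \<le> (\<Sum>i\<in>UNIV. f (cls i))"
    unfolding V by (intro sum_mono)
  also have "\<dots> = (\<Sum>q\<in>{HR, HP, LR, LP}. real (card {i. cls i = q}) * f q)"
    by (subst sum_by_class[where cls = cls]) simp
  also have "\<dots> = real (CARD('n)) / 4 * (2 * M * a - m * b)"
  proof -
    have "real (card {i. cls i = q}) = real (CARD('n)) / 4" for q
    proof -
      have "real (4 * card {i. cls i = q}) = real (CARD('n))"
        using cls unfolding equal_classes_def by presburger
      then show ?thesis by simp
    qed
    then have "(\<Sum>q\<in>{HR, HP, LR, LP}. real (card {i. cls i = q}) * f q)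
        = real (CARD('n)) / 4 * (\<Sum>q\<in>{HR, HP, LR, LP}. f q)"
      unfolding sum_distrib_left by (intro sum.cong) (simp_all only:)
    then show ?thesis
      by (simp add: f_def)
  qed
  also have "\<dots> < 0"
    using pos(2) by (intro mult_pos_neg) auto
  finally show ?thesis by simp
qed

section \<open>Marginal comparison loss and marginal utility\<close>

locale status_game =
  fixes Y :: "real set" and u :: "real \<Rightarrow> real \<Rightarrow> real" and F \<phi> :: "real \<Rightarrow> real"
  assumes open_Y: "open Y" and interval_Y: "is_interval Y"
    and utility: "consumption_utility Y u"
    and F_zero: "F 0 = 0" and F_pos: "\<And>t. 0 < t \<Longrightarrow> 0 < F t"
    and deriv_loss: "\<And>t. ((\<lambda>t. F (max 0 t)) has_real_derivative \<phi> t) (at t)"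
    and continuous_\<phi>: "continuous_on UNIV \<phi>" and \<phi>_zero: "\<phi> 0 = 0"
    and convex_loss: "convex_on UNIV (\<lambda>t. F (max 0 t))"
begin

definition \<Phi> :: "real \<Rightarrow> real" where "\<Phi> t = F (max 0 t)"

definition ux :: "real \<Rightarrow> real \<Rightarrow> real" where "ux = partial_x u"

lemma \<Phi>_nonpos [simp]: "t \<le> 0 \<Longrightarrow> \<Phi> t = 0"
  by (simp add: \<Phi>_def F_zero max_absorb1)

lemma \<Phi>_pos: "0 < t \<Longrightarrow> 0 < \<Phi> t"
  by (simp add: \<Phi>_def F_pos)

lemma \<Phi>_nonneg: "0 \<le> \<Phi> t"
  by (cases "t \<le> 0") (simp_all add: \<Phi>_pos less_imp_le)

lemma deriv_\<Phi>: "(\<Phi> has_real_derivative \<phi> t) (at t)"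
  using deriv_loss[of t] by (simp add: \<Phi>_def[abs_def])

text \<open>A convex function lies above its tangents. The sign and monotonicity of
  \<open>\<phi>\<close> and the monotonicity of \<open>\<Phi>\<close> all come from this
  inequality.\<close>

lemma \<Phi>_tangent: "\<phi> b * (a - b) \<le> \<Phi> a - \<Phi> b"
proof -
  have "\<phi> b * (a - b) \<le> F (max 0 a) - F (max 0 b)"
    by (rule convex_on_imp_above_tangent[OF convex_loss _ _ _ deriv_loss]) simp_all
  then show ?thesis
    by (simp add: \<Phi>_def)
qed

lemma mono_\<phi>: "a \<le> b \<Longrightarrow> \<phi> a \<le> \<phi> b"
proof (cases "a = b")
  assume "a \<le> b" "a \<noteq> b"
  have "(\<phi> a - \<phi> b) * (b - a) \<le> 0"
    using \<Phi>_tangent[of a b] \<Phi>_tangent[of b a] by (simp add: algebra_simps)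
  then show ?thesis
    using \<open>a \<le> b\<close> \<open>a \<noteq> b\<close> by (simp add: mult_le_0_iff)
qed simp

lemma \<phi>_nonneg: "0 \<le> \<phi> t"
proof -
  \<comment> \<open>The tangent at \<open>min t 0\<close>, evaluated one unit further left, rules
    out a negative slope, as \<open>\<Phi>\<close> vanishes at both points; monotonicity and
    \<open>\<phi>_zero\<close> rule out a positive one.\<close>
  have "\<phi> (min t 0) = 0"
    using \<Phi>_tangent[of "min t 0" "min t 0 - 1"] mono_\<phi>[of "min t 0" 0] \<phi>_zero by simp
  then show ?thesis
    using mono_\<phi>[of "min t 0" t] by simp
qed

lemma \<phi>_nonpos [simp]: "t \<le> 0 \<Longrightarrow> \<phi> t = 0"
  using mono_\<phi>[of t 0] \<phi>_nonneg[of t] \<phi>_zero by simp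

lemma mono_\<Phi>: "a \<le> b \<Longrightarrow> \<Phi> a \<le> \<Phi> b"
  using \<Phi>_tangent[of a b] mult_nonneg_nonneg[OF \<phi>_nonneg[of a], of "b - a"] by linarith

lemma C1_u: "C1_strip Y u" "C1_strip Y ux"
  using utility[unfolded consumption_utility_def, THEN conjunct1]
  unfolding C2_strip_def ux_def by blast+

lemma deriv_u:
  assumes "0 \<le> x" "e \<in> Y"
  shows "((\<lambda>t. u t e) has_real_derivative ux x e) (at x within {0..})"
proof -
  have "(\<lambda>t. u t e) differentiable (at x within {0..})"
    using C1_u(1) assms unfolding C1_strip_def by blast
  then show ?thesis
    unfolding ux_def partial_x_def has_real_derivative_iff_has_vector_derivative
    by (rule vector_derivative_works[THEN iffD1])
qed

lemma deriv_ux: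
  assumes "0 \<le> x" "e \<in> Y"
  shows "((\<lambda>t. ux t e) has_real_derivative partial_x ux x e) (at x within {0..})"
proof -
  have "(\<lambda>t. ux t e) differentiable (at x within {0..})"
    using C1_u(2) assms unfolding C1_strip_def by blast
  then show ?thesis
    unfolding partial_x_def[of ux] has_real_derivative_iff_has_vector_derivative
    by (rule vector_derivative_works[THEN iffD1])
qed

lemma partial_ux_neg: "0 \<le> x \<Longrightarrow> e \<in> Y \<Longrightarrow> partial_x ux x e < 0"
proof -
  assume "0 \<le> x" "e \<in> Y"
  then show ?thesis
    using utility[unfolded consumption_utility_def, THEN conjunct2, THEN conjunct1] by (simp add: ux_def)
qed

lemma ux_strict_antimono:
  assumes "0 \<le> a" "a < b" "e \<in> Y"
  shows "ux b e < ux a e"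
proof -
  obtain x where "a < x" "x < b" "ux b e - ux a e = partial_x ux x e * (b - a)"
    using mvt_half_line[of "\<lambda>t. ux t e" "\<lambda>x. partial_x ux x e", OF deriv_ux[OF _ assms(3)] assms(1,2)] by blast
  moreover have "partial_x ux x e * (b - a) < 0"
    using partial_ux_neg[of x e] assms \<open>a < x\<close> by (simp add: mult_less_0_iff)
  ultimately show ?thesis by simp
qed

lemma deriv_ux_e:
  assumes "0 \<le> x" "e \<in> Y"
  shows "(ux x has_real_derivative partial_y ux x e) (at e)"
proof -
  have "ux x differentiable (at e)"
    using C1_u(2) assms unfolding C1_strip_def by blast
  then show ?thesis
    unfolding partial_y_def by (rule DERIV_deriv_iff_real_differentiable[THEN iffD2])
qed

lemma ux_strict_mono:
  assumes "0 < x" "a \<in> Y" "b \<in> Y" "a < b"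
  shows "ux x a < ux x b"
proof (rule DERIV_pos_imp_increasing[OF \<open>a < b\<close>])
  fix e assume "a \<le> e" "e \<le> b"
  then have "e \<in> Y"
    using interval_Y assms by (meson mem_is_interval_1_I)
  then show "\<exists>l. DERIV (ux x) e :> l \<and> 0 < l"
    using deriv_ux_e[of x e] utility assms(1)
    by (auto simp: consumption_utility_def ux_def)
qed

text \<open>The autarky choice is an interior maximum, so the derivative within the half-line is
  two-sided there and vanishes.\<close>

lemma autarky_foc:
  assumes "e \<in> Y"
  obtains x where "0 < x" "ux x e = 0"
proof -
  define x where "x = autarky_choice u e"
  have "is_arg_max (\<lambda>x. u x e) (\<lambda>x. 0 \<le> x) x" and "0 < x"
    using utility assms unfolding consumption_utility_def x_def autarky_choice_def arg_max_def
    by (auto intro: someI_ex)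
  then have max: "u t e \<le> u x e" if "0 \<le> t" for t
    using that by (auto simp: is_arg_max_def not_less)
  have "((\<lambda>t. u t e) has_real_derivative ux x e) (at x within {0<..})"
    using deriv_u[of x e] \<open>0 < x\<close> assms by (auto intro: DERIV_subset)
  then have "((\<lambda>t. u t e) has_real_derivative ux x e) (at x)"
    using \<open>0 < x\<close> by (simp add: at_within_open[of x "{0<..}"])
  then have "ux x e = 0"
    by (rule DERIV_local_max[OF _ \<open>0 < x\<close>]) (use max in auto)
  with \<open>0 < x\<close> that show thesis by blast
qed

text \<open>Marginal utility falls strictly from 0 to the positive autarky choice, where it
  vanishes. This replaces \<open>ux_strict_mono\<close> at zero consumption, where the cross
  derivative has no prescribed sign.\<close>

lemma ux_zero_pos: "e \<in> Y \<Longrightarrow> 0 < ux 0 e"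
proof -
  assume "e \<in> Y"
  then obtain x where "0 < x" "ux x e = 0"
    by (rule autarky_foc)
  then show ?thesis
    using ux_strict_antimono[of 0 x e] \<open>e \<in> Y\<close> by simp
qed

section \<open>Best replies and first-order conditions\<close>

text \<open>The core of the comparison arguments: at the same potential, two first-order conditions
  cannot both hold if the larger choice goes with a weakly smaller comparison term.\<close>

lemma foc_strict_antimono:
  assumes "e \<in> Y" "0 \<le> a" "a < b" "k' \<le> k"
  shows "ux b e + k' < ux a e + k"
  using ux_strict_antimono[of a b e] assms by simp

text \<open>Here \<open>K\<close> is the comparison loss as a function of own consumption and
  \<open>h\<close> the negative of its derivative. The marginal payoff is strictly decreasing, so
  the payoff rises strictly up to its zero and falls strictly after it.\<close>

lemma foc_imp_unique_max:
  assumes "e \<in> Y" and K: "\<And>z. (K has_real_derivative - h z) (at z)"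
    and h: "\<And>a b. a \<le> b \<Longrightarrow> h b \<le> h a"
    and "0 \<le> z" and foc: "ux z e + h z = 0" and "0 \<le> t" and "t \<noteq> z"
  shows "u t e - K t < u z e - K z"
proof -
  have der: "((\<lambda>z. u z e - K z) has_real_derivative ux x e + h x) (at x within {0..})" if "0 \<le> x" for x
    using DERIV_diff[OF deriv_u[OF that \<open>e \<in> Y\<close>] has_field_derivative_at_within[OF K]] by simp
  show ?thesis
  proof (cases "t < z")
    case True
    obtain x where x: "t < x" "x < z"
      and eq: "(u z e - K z) - (u t e - K t) = (ux x e + h x) * (z - t)"
      using mvt_half_line[of "\<lambda>z. u z e - K z" "\<lambda>x. ux x e + h x", OF der \<open>0 \<le> t\<close> True] by blast
    have "0 < ux x e + h x"
      using foc_strict_antimono[OF \<open>e \<in> Y\<close> _ x(2) h[of x z]] x \<open>0 \<le> t\<close> foc by simp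
    then have "0 < (ux x e + h x) * (z - t)"
      using True by simp
    with eq show ?thesis by linarith
  next
    case False
    then have "z < t" using \<open>t \<noteq> z\<close> by simp
    then obtain x where x: "z < x" "x < t"
      and eq: "(u t e - K t) - (u z e - K z) = (ux x e + h x) * (t - z)"
      using mvt_half_line[of "\<lambda>z. u z e - K z" "\<lambda>x. ux x e + h x", OF der \<open>0 \<le> z\<close>] by blast
    have "ux x e + h x < 0"
      using foc_strict_antimono[OF \<open>e \<in> Y\<close> \<open>0 \<le> z\<close> x(1) h[of z x]] x foc by simp
    then have "(ux x e + h x) * (t - z) < 0"
      using \<open>z < t\<close> by (simp add: mult_less_0_iff)
    with eq show ?thesis by linarith
  qed
qed

text \<open>Intermediate value theorem between the autarky choice \<open>a\<close>, where the
  marginal payoff is \<open>h a \<ge> 0\<close>, and \<open>max a R\<close>, where the comparison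
  term is gone and marginal utility is at most 0.\<close>

lemma foc_solution:
  assumes "e \<in> Y" and h: "\<And>a b. a \<le> b \<Longrightarrow> h b \<le> h a"
    and cont: "continuous_on UNIV h" and nonneg: "\<And>z. 0 \<le> h z" and "h R = (0::real)"
  obtains z where "0 \<le> z" "ux z e + h z = 0"
proof -
  obtain a where a: "0 < a" "ux a e = 0"
    using autarky_foc[OF \<open>e \<in> Y\<close>] by blast
  define b where "b = max a R"
  then have "a \<le> b" by simp
  have "h b = 0"
    using h[of R b] nonneg[of b] \<open>h R = 0\<close> by (simp add: b_def)
  moreover have "ux b e \<le> 0"
    using ux_strict_antimono[of a b e] a \<open>a \<le> b\<close> \<open>e \<in> Y\<close> by (cases "a = b") auto
  moreover have "continuous_on {a..b} (\<lambda>z. ux z e + h z)"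
  proof (intro continuous_intros)
    show "continuous_on {a..b} (\<lambda>z. ux z e)"
      using deriv_ux[OF _ \<open>e \<in> Y\<close>] a
      by (intro continuous_on_subset[OF DERIV_continuous_on[of "{0..}"]]) auto
  qed (use cont continuous_on_subset in blast)
  ultimately obtain z where "a \<le> z" "ux z e + h z = 0"
    using IVT2'[of "\<lambda>z. ux z e + h z" b 0 a] a nonneg[of a] \<open>a \<le> b\<close> by auto
  then show thesis
    using that[of z] a by auto
qed

text \<open>A solution of the first-order condition exists and is the only maximiser, so every
  maximiser satisfies the condition; a maximum at the boundary 0 needs no separate
  treatment.\<close>

lemma max_iff_foc:
  assumes "e \<in> Y" and K: "\<And>z. (K has_real_derivative - h z) (at z)"
    and h: "\<And>a b. a \<le> b \<Longrightarrow> h b \<le> h a"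
    and "continuous_on UNIV h" and "\<And>z. 0 \<le> h z" and "h R = 0" and "0 \<le> z"
  shows "(\<forall>t\<ge>0. u t e - K t \<le> u z e - K z) \<longleftrightarrow> ux z e + h z = 0"
proof
  assume max: "\<forall>t\<ge>0. u t e - K t \<le> u z e - K z"
  obtain z' where z': "0 \<le> z'" "ux z' e + h z' = 0"
    using foc_solution[of e h R] assms by blast
  then have "z = z'"
    using foc_imp_unique_max[OF \<open>e \<in> Y\<close> K h z' \<open>0 \<le> z\<close>] max by force
  with z' show "ux z e + h z = 0" by simp
next
  assume "ux z e + h z = 0"
  then show "\<forall>t\<ge>0. u t e - K t \<le> u z e - K z"
    using foc_imp_unique_max[OF \<open>e \<in> Y\<close> K h \<open>0 \<le> z\<close>] by (metis less_imp_le order_refl)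
qed

section \<open>Nash equilibria of the game among all agents\<close>

lemma payoff_eq: "payoff u F e G x i = u (x $ i) (e i) - (\<Sum>j\<in>UNIV. G $ i $ j * \<Phi> (x $ j - x $ i))"
proof -
  have "(\<Sum>j | x $ i \<le> x $ j. G $ i $ j * F (x $ j - x $ i)) = (\<Sum>j | x $ i \<le> x $ j. G $ i $ j * \<Phi> (x $ j - x $ i))"
    by (intro sum.cong) (auto simp: \<Phi>_def max_absorb2)
  also have "\<dots> = (\<Sum>j\<in>UNIV. G $ i $ j * \<Phi> (x $ j - x $ i))"
    by (intro sum.mono_neutral_left) auto
  finally show ?thesis by (simp add: payoff_def)
qed

lemma payoff_deviation:
  assumes "G $ i $ i = 0"
  shows "payoff u F e G (\<chi> j. if j = i then z else x $ j) i
    = u z (e i) - (\<Sum>j\<in>UNIV. G $ i $ j * \<Phi> (x $ j - z))"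
proof -
  have "(\<Sum>j\<in>UNIV. G $ i $ j * \<Phi> ((if j = i then z else x $ j) - z)) = (\<Sum>j\<in>UNIV. G $ i $ j * \<Phi> (x $ j - z))"
    using assms by (intro sum.cong) auto
  then show ?thesis
    by (simp add: payoff_eq)
qed

lemma nash_equilibrium_iff_foc:
  assumes G: "\<forall>i j. 0 \<le> G $ i $ j" "\<forall>i. G $ i $ i = 0" and e: "\<And>i. e i \<in> Y"
  shows "nash_equilibrium u F e G x \<longleftrightarrow>
    (\<forall>i. 0 \<le> x $ i \<and> ux (x $ i) (e i) + (\<Sum>j\<in>UNIV. G $ i $ j * \<phi> (x $ j - x $ i)) = 0)"
proof -
  \<comment> \<open>An agent consuming the maximum of all choices has nobody above, which supplies
    the level \<open>R\<close> at which the comparison term vanishes.\<close>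
  have foc: "(\<forall>t\<ge>0. u t (e i) - (\<Sum>j\<in>UNIV. G $ i $ j * \<Phi> (x $ j - t))
           \<le> u (x $ i) (e i) - (\<Sum>j\<in>UNIV. G $ i $ j * \<Phi> (x $ j - x $ i)))
      \<longleftrightarrow> ux (x $ i) (e i) + (\<Sum>j\<in>UNIV. G $ i $ j * \<phi> (x $ j - x $ i)) = 0" if "0 \<le> x $ i" for i
  proof (rule max_iff_foc[OF e, where K = "\<lambda>t. \<Sum>j\<in>UNIV. G $ i $ j * \<Phi> (x $ j - t)"
        and h = "\<lambda>t. \<Sum>j\<in>UNIV. G $ i $ j * \<phi> (x $ j - t)" and R = "Max (range (($) x))"])
    fix z
    have "((\<lambda>t. G $ i $ j * \<Phi> (x $ j - t)) has_real_derivative G $ i $ j * - \<phi> (x $ j - z)) (at z)" for j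
      by (auto intro!: derivative_eq_intros DERIV_chain2[OF deriv_\<Phi>])
    then show "((\<lambda>t. \<Sum>j\<in>UNIV. G $ i $ j * \<Phi> (x $ j - t)) has_real_derivative
        - (\<Sum>j\<in>UNIV. G $ i $ j * \<phi> (x $ j - z))) (at z)"
      by (auto simp flip: sum_negf intro!: DERIV_sum)
  next
    show "continuous_on UNIV (\<lambda>t. \<Sum>j\<in>UNIV. G $ i $ j * \<phi> (x $ j - t))"
      by (intro continuous_intros continuous_on_compose2[OF continuous_\<phi>]) auto
  qed (use G that \<phi>_nonneg mono_\<phi> in \<open>auto intro!: sum_mono mult_left_mono sum_nonneg\<close>)
  show ?thesis
    unfolding nash_equilibrium_def payoff_deviation[OF G(2)[rule_format]]
    unfolding payoff_eq
    by (simp only: all_conj_distrib foc cong: conj_cong)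
qed

text \<open>At the agent where \<open>x - x'\<close> is largest, every gap \<open>x\<^sub>j - x\<^sub>i\<close> is at most the one under \<open>x'\<close>, so a
  positive difference contradicts the first-order conditions.\<close>

lemma nash_equilibrium_unique:
  fixes x x' :: "real^'n::finite"
  assumes G: "\<forall>i j. 0 \<le> G $ i $ j" "\<forall>i. G $ i $ i = 0" and e: "\<And>i. e i \<in> Y"
    and x: "nash_equilibrium u F e G x" and x': "nash_equilibrium u F e G x'"
  shows "x = x'"
proof -
  have le: "z $ i \<le> z' $ i" if z: "nash_equilibrium u F e G z" and z': "nash_equilibrium u F e G z'" for z z' i
  proof (rule ccontr)
    assume "\<not> z $ i \<le> z' $ i"
    let ?R = "range (\<lambda>i. z $ i - z' $ i)"
    have "Max ?R \<in> ?R"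
      by (intro Max_in) auto
    then obtain k where k_max: "Max ?R = z $ k - z' $ k"
      by (rule rangeE)
    have k: "z $ j - z' $ j \<le> z $ k - z' $ k" for j
      unfolding k_max[symmetric] by (intro Max_ge) auto
    from k[of i] \<open>\<not> _\<close> have "z' $ k < z $ k" by simp
    have foc: "0 \<le> z' $ k"
      "ux (z $ k) (e k) + (\<Sum>j\<in>UNIV. G $ k $ j * \<phi> (z $ j - z $ k)) = 0"
      "ux (z' $ k) (e k) + (\<Sum>j\<in>UNIV. G $ k $ j * \<phi> (z' $ j - z' $ k)) = 0"
      using z z' unfolding nash_equilibrium_iff_foc[where e = e, OF G e] by blast+
    have "z $ j - z $ k \<le> z' $ j - z' $ k" for j
      using k[of j] by simp
    then have "(\<Sum>j\<in>UNIV. G $ k $ j * \<phi> (z $ j - z $ k)) \<le> (\<Sum>j\<in>UNIV. G $ k $ j * \<phi> (z' $ j - z' $ k))"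
      using G by (intro sum_mono mult_left_mono mono_\<phi>) auto
    from foc_strict_antimono[OF e[of k] foc(1) \<open>z' $ k < z $ k\<close> this] foc show False by simp
  qed
  show ?thesis
    using le[OF x x'] le[OF x' x] by (simp add: vec_eq_iff order_antisym)
qed

section \<open>Reduction to the choices of the four classes\<close>

text \<open>In equilibrium a class looks up to at most two other classes; a class with a single
  reference is covered by \<open>l = 0\<close>.\<close>

lemma two_link_foc:
  assumes "0 \<le> k" "0 \<le> l"
  shows "((\<lambda>z. k * \<Phi> (a - z) + l * \<Phi> (b - z)) has_real_derivative - (k * \<phi> (a - z) + l * \<phi> (b - z))) (at z)"
    and "z \<le> z' \<Longrightarrow> k * \<phi> (a - z') + l * \<phi> (b - z') \<le> k * \<phi> (a - z) + l * \<phi> (b - z)"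
    and "continuous_on UNIV (\<lambda>z. k * \<phi> (a - z) + l * \<phi> (b - z))"
    and "0 \<le> k * \<phi> (a - z) + l * \<phi> (b - z)"
proof -
  show "((\<lambda>z. k * \<Phi> (a - z) + l * \<Phi> (b - z)) has_real_derivative - (k * \<phi> (a - z) + l * \<phi> (b - z))) (at z)"
    by (auto intro!: derivative_eq_intros DERIV_chain2[OF deriv_\<Phi>])
  show "z \<le> z' \<Longrightarrow> k * \<phi> (a - z') + l * \<phi> (b - z') \<le> k * \<phi> (a - z) + l * \<phi> (b - z)"
    using assms by (intro add_mono mult_left_mono mono_\<phi>) auto
  show "continuous_on UNIV (\<lambda>z. k * \<phi> (a - z) + l * \<phi> (b - z))"
    by (intro continuous_intros continuous_on_compose2[OF continuous_\<phi>]) auto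
  show "0 \<le> k * \<phi> (a - z) + l * \<phi> (b - z)"
    using assms \<phi>_nonneg by simp
qed

text \<open>Revealed preference at fixed weights and references; later \<open>t\<close> is the
  choice that the same class makes under a different integration.\<close>

lemma two_link_best_reply:
  assumes "e \<in> Y" "0 \<le> k" "0 \<le> l" "0 \<le> z" "0 \<le> t"
    and "ux z e + (k * \<phi> (a - z) + l * \<phi> (b - z)) = 0"
  shows "u t e - (k * \<Phi> (a - t) + l * \<Phi> (b - t)) \<le> u z e - (k * \<Phi> (a - z) + l * \<Phi> (b - z))"
proof (cases "t = z")
  case False
  have "u t e - (k * \<Phi> (a - t) + l * \<Phi> (b - t)) < u z e - (k * \<Phi> (a - z) + l * \<Phi> (b - z))"
    by (rule foc_imp_unique_max[where K = "\<lambda>z. k * \<Phi> (a - z) + l * \<Phi> (b - z)",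
          OF \<open>e \<in> Y\<close> two_link_foc(1,2)[OF assms(2,3)] assms(4,6,5) False])
  then show ?thesis by simp
qed simp

lemma two_link_solution:
  assumes "e \<in> Y" "0 \<le> k" "0 \<le> l"
  obtains z where "0 \<le> z" "ux z e + (k * \<phi> (a - z) + l * \<phi> (b - z)) = 0"
proof (rule foc_solution[where h = "\<lambda>z. k * \<phi> (a - z) + l * \<phi> (b - z)" and R = "max a b",
      OF assms(1) two_link_foc(2-4)[OF assms(2,3)]])
  show "k * \<phi> (a - max a b) + l * \<phi> (b - max a b) = 0"
    by simp
qed (assumption, rule that)

text \<open>First-order conditions with only the links on which a comparison loss can arise; that no class
  lags behind another one along the omitted links is shown in \<open>class_equilibrium_order\<close>.\<close>

definition class_equilibrium ::
  "real \<Rightarrow> real \<Rightarrow> (agent_class \<Rightarrow> real) \<Rightarrow> (agent_class \<Rightarrow> real) \<Rightarrow> bool" where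
  "class_equilibrium c \<rho> e x \<longleftrightarrow>
     (\<forall>q. 0 \<le> x q) \<and>
     ux (x HR) (e HR) = 0 \<and>
     ux (x HP) (e HP) + c * \<rho> * \<phi> (x HR - x HP) = 0 \<and>
     ux (x LR) (e LR) + c * (1 - \<rho>) * \<phi> (x HR - x LR) = 0 \<and>
     ux (x LP) (e LP) + (c * \<rho> * \<phi> (x LR - x LP) + c * (1 - \<rho>) * \<phi> (x HP - x LP)) = 0"

text \<open>The parameter \<open>c\<close> stands for \<open>d * (1 - \<omega>)\<close>: links
  inside a class involve no gap, so \<open>\<omega>\<close> matters only through
  \<open>c\<close>.\<close>

fun class_payoff ::
  "real \<Rightarrow> real \<Rightarrow> (agent_class \<Rightarrow> real) \<Rightarrow> (agent_class \<Rightarrow> real) \<Rightarrow> agent_class \<Rightarrow> real" where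
  "class_payoff c \<rho> e x (High, Rich) = u (x HR) (e HR)"
| "class_payoff c \<rho> e x (High, Poor) = u (x HP) (e HP) - c * \<rho> * \<Phi> (x HR - x HP)"
| "class_payoff c \<rho> e x (Low, Rich) = u (x LR) (e LR) - c * (1 - \<rho>) * \<Phi> (x HR - x LR)"
| "class_payoff c \<rho> e x (Low, Poor) =
     u (x LP) (e LP) - (c * \<rho> * \<Phi> (x LR - x LP) + c * (1 - \<rho>) * \<Phi> (x HP - x LP))"

text \<open>HP and LR are not ordered relative to each other, which makes the condition invariant
  under exchanging them.\<close>

definition ordered_potentials :: "(agent_class \<Rightarrow> real) \<Rightarrow> bool" where
  "ordered_potentials e \<longleftrightarrow> e LP \<in> Y \<and> e HR \<in> Y \<and>
     e LP < e HP \<and> e HP < e HR \<and> e LP < e LR \<and> e LR < e HR"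

lemma ordered_potentials_in_Y:
  assumes "ordered_potentials e"
  shows "e q \<in> Y"
proof -
  have "e LP \<le> e q \<and> e q \<le> e HR"
    using assms by (cases q rule: agent_class_cases) (simp_all add: ordered_potentials_def)
  then show ?thesis
    using mem_is_interval_1_I[OF interval_Y, of "e LP" "e HR" "e q"] assms
    by (simp add: ordered_potentials_def)
qed

text \<open>The conditions are solved from the top down: HR alone, then HP and LR given HR, then LP
  given both of these.\<close>

lemma class_equilibrium_exists:
  assumes "ordered_potentials e" "0 \<le> c" "0 < \<rho>" "\<rho> < 1"
  obtains x where "class_equilibrium c \<rho> e x"
proof -
  note Y = ordered_potentials_in_Y[OF assms(1)]
  obtain X where X: "0 < X" "ux X (e HR) = 0"
    using autarky_foc[OF Y] by blast
  obtain a where a: "0 \<le> a" "ux a (e HP) + (c * \<rho> * \<phi> (X - a) + 0 * \<phi> (X - a)) = 0"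
    using two_link_solution[OF Y[of HP], of "c * \<rho>" 0 X X] assms by auto
  obtain b where b: "0 \<le> b" "ux b (e LR) + (c * (1 - \<rho>) * \<phi> (X - b) + 0 * \<phi> (X - b)) = 0"
    using two_link_solution[OF Y[of LR], of "c * (1 - \<rho>)" 0 X X] assms by auto
  obtain t where t: "0 \<le> t" "ux t (e LP) + (c * \<rho> * \<phi> (b - t) + c * (1 - \<rho>) * \<phi> (a - t)) = 0"
    using two_link_solution[OF Y[of LP], of "c * \<rho>" "c * (1 - \<rho>)" b a] assms by auto
  show thesis
    using that[of "\<lambda>q. if q = HR then X else if q = HP then a else if q = LR then b else t"] X a b t
    by (simp add: class_equilibrium_def)
qed

lemma class_equilibrium_order:
  assumes e: "ordered_potentials e" and c: "0 \<le> c" "0 < \<rho>" "\<rho> < 1" and x: "class_equilibrium c \<rho> e x"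
  shows "x HP < x HR" "x LR < x HR" "x LP \<le> x HP" "x LP \<le> x LR"
proof -
  note Y = ordered_potentials_in_Y[OF e]
  have nonneg: "0 \<le> x q" for q
    using x unfolding class_equilibrium_def by blast
  have foc: "ux (x HR) (e HR) = 0"
    "ux (x HP) (e HP) + c * \<rho> * \<phi> (x HR - x HP) = 0"
    "ux (x LR) (e LR) + c * (1 - \<rho>) * \<phi> (x HR - x LR) = 0"
    "ux (x LP) (e LP) + (c * \<rho> * \<phi> (x LR - x LP) + c * (1 - \<rho>) * \<phi> (x HP - x LP)) = 0"
    using x unfolding class_equilibrium_def by blast+
  have e_order: "e LP < e HP" "e HP < e HR" "e LP < e LR" "e LR < e HR"
    using e unfolding ordered_potentials_def by blast+
  have "x HR \<noteq> 0"
    using ux_zero_pos[OF Y, of HR] foc(1) by force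
  then have "0 < x HR"
    using nonneg[of HR] by simp
  \<comment> \<open>A class at or above HR would suffer no loss, so its marginal utility would
    vanish at a consumption of at least \<open>x HR\<close> despite its lower potential, although it
    is negative there.\<close>
  have below_top: "x q < x HR" if "ux (x q) (e q) + k * \<phi> (x HR - x q) = 0" "e q < e HR" for q k
  proof (rule ccontr)
    assume "\<not> x q < x HR"
    then have "x HR \<le> x q" by simp
    then have "ux (x q) (e q) = 0"
      using that(1) by simp
    moreover have "ux (x q) (e q) \<le> ux (x HR) (e q)"
      using ux_strict_antimono[OF nonneg[of HR] _ Y[of q], of "x q"] \<open>x HR \<le> x q\<close>
      by (cases "x q = x HR") auto
    moreover have "ux (x HR) (e q) < ux (x HR) (e HR)"
      using ux_strict_mono[OF \<open>0 < x HR\<close> Y Y that(2)] .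
    ultimately show False
      using foc(1) by simp
  qed
  show HP: "x HP < x HR" and LR: "x LR < x HR"
    using below_top foc(2,3) e_order(2,4) by blast+
  \<comment> \<open>If LP consumed more than \<open>q\<close>, its comparison to \<open>q\<close>
    would vanish. Its other link has the same weight \<open>k\<close> as the link from
    \<open>q\<close> to HR but a smaller gap, so the marginal payoff of \<open>q\<close>, at lower
    consumption and higher potential, would be positive.\<close>
  have above_bottom: "x LP \<le> x q"
    if "ux (x q) (e q) + k * \<phi> (x HR - x q) = 0" "x q' < x HR"
      and "ux (x LP) (e LP) + (k * \<phi> (x q' - x LP) + l * \<phi> (x q - x LP)) = 0"
      and "0 \<le> k" and "e LP < e q" for q q' k l
  proof (rule ccontr)
    assume "\<not> x LP \<le> x q"
    have "k * \<phi> (x q' - x LP) \<le> k * \<phi> (x HR - x q)"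
      using that \<open>\<not> x LP \<le> x q\<close> by (intro mult_left_mono mono_\<phi>) auto
    then have "ux (x LP) (e LP) + k * \<phi> (x q' - x LP) < ux (x q) (e LP) + k * \<phi> (x HR - x q)"
      using \<open>\<not> x LP \<le> x q\<close> by (intro foc_strict_antimono Y nonneg) auto
    with that(3) \<open>\<not> x LP \<le> x q\<close>
    have "0 < ux (x q) (e LP) + k * \<phi> (x HR - x q)"
      by simp
    moreover have "ux (x q) (e LP) \<le> ux (x q) (e q)"
    proof (cases "x q = 0")
      case False
      then show ?thesis
        using ux_strict_mono[OF _ Y Y \<open>e LP < e q\<close>, of "x q"] nonneg[of q] by simp
    next
      case True
      then have "0 < ux (x q) (e q)"
        using ux_zero_pos[OF Y] by simp
      moreover have "0 \<le> k * \<phi> (x HR - x q)"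
        using \<open>0 \<le> k\<close> \<phi>_nonneg by simp
      ultimately show ?thesis
        using that(1) by linarith
    qed
    ultimately show False
      using that(1) by simp
  qed
  show "x LP \<le> x HP"
    using above_bottom[OF foc(2) LR foc(4)] c e_order(1) by simp
  \<comment> \<open>The argument is repeated with HP and LR, and the two weights, exchanged.\<close>
  have "ux (x LP) (e LP) + (c * (1 - \<rho>) * \<phi> (x HP - x LP) + c * \<rho> * \<phi> (x LR - x LP)) = 0"
    using foc(4) by (simp only: add.commute)
  from above_bottom[OF foc(3) HP this] show "x LP \<le> x LR"
    using c e_order(3) by simp
qed

text \<open>The profile that is constant on classes satisfies every agent's first-order condition:
  gaps inside a class are 0, and the order of the choices removes all downward comparisons.
  Uniqueness identifies this profile with the one picked by \<open>THE\<close>.\<close>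

lemma equilibrium_payoffs_by_class:
  fixes cls :: "'n::finite \<Rightarrow> agent_class"
  assumes e: "ordered_potentials e" and "0 < d" "0 < \<omega>" "\<omega> < 1" "0 < \<rho>" "\<rho> < 1"
    and G: "network cls d \<omega> \<rho> G"
  obtains x where "class_equilibrium (d * (1 - \<omega>)) \<rho> e x"
    and "\<And>i. equilibrium_payoffs u F (\<lambda>i. e (cls i)) G $ i = class_payoff (d * (1 - \<omega>)) \<rho> e x (cls i)"
proof -
  let ?c = "d * (1 - \<omega>)"
  have c: "0 \<le> ?c"
    using assms by simp
  obtain x where x: "class_equilibrium ?c \<rho> e x"
    using class_equilibrium_exists[OF e c] assms by blast
  note order = class_equilibrium_order[OF e c \<open>0 < \<rho>\<close> \<open>\<rho> < 1\<close> x]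
  have G': "\<forall>i j. 0 \<le> G $ i $ j" "\<forall>i. G $ i $ i = 0"
    using G by (auto simp: network_def)
  note Y = ordered_potentials_in_Y[OF e]
  define z :: "real^'n" where "z = (\<chi> i. x (cls i))"
  have foc: "ux (x HR) (e HR) = 0"
    "ux (x HP) (e HP) + ?c * \<rho> * \<phi> (x HR - x HP) = 0"
    "ux (x LR) (e LR) + ?c * (1 - \<rho>) * \<phi> (x HR - x LR) = 0"
    "ux (x LP) (e LP) + (?c * \<rho> * \<phi> (x LR - x LP) + ?c * (1 - \<rho>) * \<phi> (x HP - x LP)) = 0"
    using x unfolding class_equilibrium_def by blast+
  have "ux (x (cls i)) (e (cls i)) + (\<Sum>j\<in>UNIV. G $ i $ j * \<phi> (x (cls j) - x (cls i))) = 0" for i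
    unfolding network_sum[OF G, of i "\<lambda>q. \<phi> (x q - x (cls i))"]
    using foc order
    by (cases "cls i" rule: agent_class_cases) (simp_all add: link_share_def algebra_simps)
  then have z: "nash_equilibrium u F (\<lambda>i. e (cls i)) G z"
    using x unfolding nash_equilibrium_iff_foc[where e = "\<lambda>i. e (cls i)", OF G' Y]
      class_equilibrium_def z_def vec_lambda_beta by blast
  then have "(THE x. nash_equilibrium u F (\<lambda>i. e (cls i)) G x) = z"
    using nash_equilibrium_unique[where e = "\<lambda>i. e (cls i)", OF G' Y] by blast
  then have payoffs: "equilibrium_payoffs u F (\<lambda>i. e (cls i)) G $ i
      = u (x (cls i)) (e (cls i)) - (\<Sum>j\<in>UNIV. G $ i $ j * \<Phi> (x (cls j) - x (cls i)))" for i
    by (simp add: equilibrium_payoffs_def payoff_eq z_def)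
  have "equilibrium_payoffs u F (\<lambda>i. e (cls i)) G $ i = class_payoff ?c \<rho> e x (cls i)" for i
    unfolding payoffs network_sum[OF G, of i "\<lambda>q. \<Phi> (x q - x (cls i))"]
    using order by (cases "cls i" rule: agent_class_cases) (simp_all add: link_share_def algebra_simps)
  with x show thesis by (rule that)
qed

section \<open>Response of class payoffs to integration\<close>

text \<open>The continuous negative second derivative attains its maximum \<open>- \<mu>\<close> on
  a compact rectangle. Uniformity in the potential keeps the later bounds independent of
  mobility.\<close>

lemma curvature_bound:
  assumes "p \<in> Y" "r \<in> Y" "p \<le> r" "0 \<le> X"
  obtains \<mu> where "0 < \<mu>"
    and "\<And>a b e. 0 \<le> a \<Longrightarrow> a \<le> b \<Longrightarrow> b \<le> X \<Longrightarrow> p \<le> e \<Longrightarrow> e \<le> r \<Longrightarrow> \<mu> * (b - a) \<le> ux a e - ux b e"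
proof -
  have Y: "e \<in> Y" if "p \<le> e" "e \<le> r" for e
    using mem_is_interval_1_I[OF interval_Y \<open>p \<in> Y\<close> \<open>r \<in> Y\<close> that] .
  have "continuous_on ({0..} \<times> Y) (\<lambda>(x, y). partial_x ux x y)"
    using C1_u(2) unfolding C1_strip_def by blast
  then have "continuous_on ({0..X} \<times> {p..r}) (\<lambda>(x, y). partial_x ux x y)"
    by (rule continuous_on_subset) (use Y in auto)
  moreover have "compact ({0..X} \<times> {p..r})"
    by (intro compact_Times compact_Icc)
  moreover have "{0..X} \<times> {p..r} \<noteq> {}"
    using assms by auto
  ultimately obtain m where m: "m \<in> {0..X} \<times> {p..r}"
    and sup: "\<And>q. q \<in> {0..X} \<times> {p..r} \<Longrightarrow> (\<lambda>(x, y). partial_x ux x y) q \<le> (\<lambda>(x, y). partial_x ux x y) m"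
    using continuous_attains_sup[of "{0..X} \<times> {p..r}" "\<lambda>(x, y). partial_x ux x y"] by blast
  define \<mu> where "\<mu> = - partial_x ux (fst m) (snd m)"
  have "0 < \<mu>"
    using m partial_ux_neg[of "fst m" "snd m"] Y[of "snd m"] by (auto simp: \<mu>_def mem_Times_iff)
  moreover have "\<mu> * (b - a) \<le> ux a e - ux b e"
    if ab: "0 \<le> a" "a \<le> b" "b \<le> X" "p \<le> e" "e \<le> r" for a b e
  proof (cases "a = b")
    case False
    then have "a < b" using \<open>a \<le> b\<close> by simp
    then obtain x where x: "a < x" "x < b" "ux b e - ux a e = partial_x ux x e * (b - a)"
      using mvt_half_line[of "\<lambda>t. ux t e" "\<lambda>x. partial_x ux x e", OF deriv_ux[OF _ Y[OF ab(4,5)]] \<open>0 \<le> a\<close>]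
      by blast
    have "partial_x ux x e \<le> - \<mu>"
      using sup[of "(x, e)"] x ab by (auto simp: \<mu>_def case_prod_unfold)
    then have "partial_x ux x e * (b - a) \<le> - \<mu> * (b - a)"
      using \<open>a < b\<close> by (intro mult_right_mono) auto
    with x(3) show ?thesis by simp
  qed simp
  ultimately show thesis by (rule that)
qed

lemma ux_pos_near:
  assumes "0 \<le> x" "r \<in> Y" "0 < ux x r"
  obtains \<delta> where "0 < \<delta>" "\<And>e. r - \<delta> < e \<Longrightarrow> e < r \<Longrightarrow> 0 < ux x e"
proof -
  have "isCont (ux x) r"
    using DERIV_isCont[OF deriv_ux_e[OF assms(1,2)]] .
  then have "eventually (\<lambda>e. 0 < ux x e) (at r)"
    using order_tendstoD(1)[of "ux x" "ux x r" "at r" 0] assms(3) by (simp add: isCont_def)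
  then obtain \<delta> where "0 < \<delta>" "\<And>e. e \<noteq> r \<Longrightarrow> dist e r < \<delta> \<Longrightarrow> 0 < ux x e"
    unfolding eventually_at by auto
  with that[of \<delta>] show thesis
    by (auto simp: dist_real_def)
qed

text \<open>The choice under \<open>\<rho>'\<close> is a feasible deviation under
  \<open>\<rho>\<close>. For HP and LR the reference \<open>x HR\<close> does not move, so only the
  change of weight remains. For LP the references move too, and the fall of LR's consumption has to
  be bounded.\<close>

lemma class_payoff_comparison:
  assumes e: "ordered_potentials e" and c: "0 < c" and \<rho>: "0 < \<rho>" "\<rho> < \<rho>'" "\<rho>' < 1"
    and x: "class_equilibrium c \<rho> e x" and x': "class_equilibrium c \<rho>' e x'"
  shows "x' HR = x HR"
    and "class_payoff c \<rho>' e x' HP \<le> class_payoff c \<rho> e x HP - (\<rho>' - \<rho>) * (c * \<Phi> (x HR - x' HP))"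
    and "class_payoff c \<rho>' e x' LR \<le> class_payoff c \<rho> e x LR + (\<rho>' - \<rho>) * (c * \<Phi> (x HR - x' LR))"
    and "\<lbrakk>0 < \<mu>; \<And>a b. \<lbrakk>0 \<le> a; a \<le> b; b \<le> x HR\<rbrakk> \<Longrightarrow> \<mu> * (b - a) \<le> ux a (e LR) - ux b (e LR);
      x' HP \<le> x' LR\<rbrakk> \<Longrightarrow>
      class_payoff c \<rho>' e x' LP \<le> class_payoff c \<rho> e x LP
        + (\<rho>' - \<rho>) * (c * (\<phi> (x HR) * (c * \<phi> (x HR - x' LR) / \<mu>)))"
proof -
  note Y = ordered_potentials_in_Y[OF e]
  have nonneg: "0 \<le> x q" "0 \<le> x' q" for q
    using x x' unfolding class_equilibrium_def by blast+
  have foc: "ux (x HR) (e HR) = 0"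
    "ux (x HP) (e HP) + c * \<rho> * \<phi> (x HR - x HP) = 0"
    "ux (x LR) (e LR) + c * (1 - \<rho>) * \<phi> (x HR - x LR) = 0"
    "ux (x LP) (e LP) + (c * \<rho> * \<phi> (x LR - x LP) + c * (1 - \<rho>) * \<phi> (x HP - x LP)) = 0"
    using x unfolding class_equilibrium_def by blast+
  have foc': "ux (x' HR) (e HR) = 0"
    "ux (x' HP) (e HP) + c * \<rho>' * \<phi> (x' HR - x' HP) = 0"
    "ux (x' LR) (e LR) + c * (1 - \<rho>') * \<phi> (x' HR - x' LR) = 0"
    using x' unfolding class_equilibrium_def by blast+
  show HR: "x' HR = x HR"
    using ux_strict_antimono[OF nonneg(1)[of HR] _ Y[of HR], of "x' HR"]
      ux_strict_antimono[OF nonneg(2)[of HR] _ Y[of HR], of "x HR"] foc(1) foc'(1)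
    by (cases "x HR" "x' HR" rule: linorder_cases) auto
  have order: "x LR < x HR" "x' LR < x HR" "x' LP \<le> x' LR"
    using class_equilibrium_order(2)[OF e _ _ _ x] class_equilibrium_order(2,4)[OF e _ _ _ x'] c \<rho> HR by simp_all
  \<comment> \<open>More integration puts more weight on HP's comparison to HR and less on LR's, so
    HP consumes more and LR less.\<close>
  have HP: "x HP \<le> x' HP"
  proof (rule ccontr)
    assume "\<not> x HP \<le> x' HP"
    then have "ux (x HP) (e HP) + c * \<rho> * \<phi> (x HR - x HP) < ux (x' HP) (e HP) + c * \<rho>' * \<phi> (x HR - x' HP)"
      using c \<rho> \<phi>_nonneg by (intro foc_strict_antimono Y nonneg mult_mono mono_\<phi>) auto
    then show False
      using foc(2) foc'(2) HR by simp
  qed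
  have LR: "x' LR \<le> x LR"
  proof (rule ccontr)
    assume "\<not> x' LR \<le> x LR"
    then have "ux (x' LR) (e LR) + c * (1 - \<rho>') * \<phi> (x HR - x' LR) < ux (x LR) (e LR) + c * (1 - \<rho>) * \<phi> (x HR - x LR)"
      using c \<rho> \<phi>_nonneg by (intro foc_strict_antimono Y nonneg mult_mono mono_\<phi>) auto
    then show False
      using foc(3) foc'(3) HR by simp
  qed
  show "class_payoff c \<rho>' e x' HP \<le> class_payoff c \<rho> e x HP - (\<rho>' - \<rho>) * (c * \<Phi> (x HR - x' HP))"
    using two_link_best_reply[OF Y _ _ nonneg(1) nonneg(2), of "c * \<rho>" 0 HP HP "x HR" "x HR" HP] foc(2) HR c \<rho>
    by (simp add: algebra_simps)
  show "class_payoff c \<rho>' e x' LR \<le> class_payoff c \<rho> e x LR + (\<rho>' - \<rho>) * (c * \<Phi> (x HR - x' LR))"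
    using two_link_best_reply[OF Y _ _ nonneg(1) nonneg(2), of "c * (1 - \<rho>)" 0 LR LR "x HR" "x HR" LR] foc(3) HR c \<rho>
    by (simp add: algebra_simps)
  assume \<mu>: "0 < \<mu>" and curvature: "\<And>a b. \<lbrakk>0 \<le> a; a \<le> b; b \<le> x HR\<rbrakk> \<Longrightarrow> \<mu> * (b - a) \<le> ux a (e LR) - ux b (e LR)"
    and "x' HP \<le> x' LR"
  define z where "z = x' LP"
  define A where "A = \<Phi> (x' LR - z)"
  define B where "B = \<Phi> (x' HP - z)"
  define D where "D = x LR - x' LR"
  define \<Lambda> where "\<Lambda> = \<phi> (x HR)"
  have "0 \<le> \<Lambda>" "0 \<le> D" "B \<le> A"
    using \<phi>_nonneg LR \<open>x' HP \<le> x' LR\<close> mono_\<Phi> by (simp_all add: \<Lambda>_def D_def A_def B_def)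
  \<comment> \<open>Curvature turns the change of LR's comparison term into a bound on the fall
    \<open>D\<close> of its consumption. Replacing the old gap by the larger new one leaves only the
    change of weight.\<close>
  have "\<mu> * D \<le> ux (x' LR) (e LR) - ux (x LR) (e LR)"
    unfolding D_def using curvature[OF nonneg(2) LR] order(1) by simp
  also have "\<dots> = c * (1 - \<rho>) * \<phi> (x HR - x LR) - c * (1 - \<rho>') * \<phi> (x HR - x' LR)"
    using foc(3) foc'(3) HR by simp
  also have "\<dots> \<le> c * (1 - \<rho>) * \<phi> (x HR - x' LR) - c * (1 - \<rho>') * \<phi> (x HR - x' LR)"
    using c \<rho> LR by (intro diff_right_mono mult_left_mono mono_\<phi>) auto
  also have "\<dots> = (\<rho>' - \<rho>) * (c * \<phi> (x HR - x' LR))"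
    by (simp add: algebra_simps)
  finally have D: "D \<le> (\<rho>' - \<rho>) * (c * \<phi> (x HR - x' LR) / \<mu>)"
    using \<mu> by (simp add: field_simps)
  have "\<Phi> (x LR - z) - A \<le> \<phi> (x LR - z) * D"
    using \<Phi>_tangent[of "x LR - z" "x' LR - z"] by (simp add: A_def D_def algebra_simps)
  also have "\<dots> \<le> \<Lambda> * D"
    unfolding \<Lambda>_def using \<open>0 \<le> D\<close> order nonneg(2)[of LP] by (intro mult_right_mono mono_\<phi>) (auto simp: z_def)
  finally have AD: "\<Phi> (x LR - z) \<le> A + \<Lambda> * D"
    by simp
  \<comment> \<open>Under the old weights and references LP weakly prefers its old choice to
    \<open>z\<close>, so its gain is at most the difference of the two losses at
    \<open>z\<close>.\<close>
  have "class_payoff c \<rho>' e x' LP - class_payoff c \<rho> e x LP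
      \<le> c * \<rho> * \<Phi> (x LR - z) + c * (1 - \<rho>) * \<Phi> (x HP - z) - (c * \<rho>' * A + c * (1 - \<rho>') * B)"
    using two_link_best_reply[OF Y _ _ nonneg(1) nonneg(2), of "c * \<rho>" "c * (1 - \<rho>)" LP LP "x LR" "x HP" LP]
      foc(4) c \<rho> by (simp add: A_def B_def z_def)
  also have "\<dots> \<le> c * \<rho> * (A + \<Lambda> * D) + c * (1 - \<rho>) * B - (c * \<rho>' * A + c * (1 - \<rho>') * B)"
    unfolding B_def using AD HP c \<rho> by (intro diff_right_mono add_mono mult_left_mono mono_\<Phi>) auto
  \<comment> \<open>Shifting weight from HP to the higher consumer LR yields the term with
    \<open>A - B\<close>, which can only hurt LP; any gain comes from \<open>D\<close>.\<close>
  also have "\<dots> = \<rho> * (c * (\<Lambda> * D)) - c * ((\<rho>' - \<rho>) * (A - B))"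
    by (simp add: algebra_simps)
  also have "\<dots> \<le> c * (\<Lambda> * D)"
  proof -
    have "\<rho> * (c * (\<Lambda> * D)) \<le> 1 * (c * (\<Lambda> * D))"
      using c \<rho> \<open>0 \<le> \<Lambda>\<close> \<open>0 \<le> D\<close> by (intro mult_right_mono) auto
    moreover have "0 \<le> c * ((\<rho>' - \<rho>) * (A - B))"
      using c \<rho> \<open>B \<le> A\<close> by simp
    ultimately show ?thesis by linarith
  qed
  also have "\<dots> \<le> c * (\<Lambda> * ((\<rho>' - \<rho>) * (c * \<phi> (x HR - x' LR) / \<mu>)))"
    using c D \<open>0 \<le> \<Lambda>\<close> by (intro mult_left_mono) auto
  finally show "class_payoff c \<rho>' e x' LP \<le> class_payoff c \<rho> e x LP
      + (\<rho>' - \<rho>) * (c * (\<phi> (x HR) * (c * \<phi> (x HR - x' LR) / \<mu>)))"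
    by (simp add: \<Lambda>_def algebra_simps)
qed

text \<open>The order of quantifiers matters: \<open>\<eta>\<close> is fixed before
  \<open>\<epsilon>\<close>, and \<open>\<delta>\<close> is uniform in \<open>\<rho>\<close>,
  \<open>\<rho>'\<close> and the intermediate potentials. Possible gains thus become negligible
  against the loss of HP.\<close>

lemma class_payoff_estimates:
  assumes "p \<in> Y" "r \<in> Y" "p < r" "0 < c"
  obtains \<eta> where "0 < \<eta>"
    and "\<And>\<epsilon>. 0 < \<epsilon> \<Longrightarrow> \<exists>\<delta>>0. \<forall>e \<rho> \<rho>' x x'.
      ordered_potentials e \<and> e LP = p \<and> e HR = r \<and> e HP < p + \<delta> \<and> r - \<delta> < e LR \<and>
      0 < \<rho> \<and> \<rho> < \<rho>' \<and> \<rho>' < 1 \<and> class_equilibrium c \<rho> e x \<and> class_equilibrium c \<rho>' e x' \<longrightarrow>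
      class_payoff c \<rho>' e x' HP \<le> class_payoff c \<rho> e x HP - (\<rho>' - \<rho>) * \<eta> \<and>
      class_payoff c \<rho>' e x' LR \<le> class_payoff c \<rho> e x LR + (\<rho>' - \<rho>) * \<epsilon> \<and>
      class_payoff c \<rho>' e x' LP \<le> class_payoff c \<rho> e x LP + (\<rho>' - \<rho>) * \<epsilon>"
proof -
  obtain X where X: "0 < X" "ux X r = 0"
    using autarky_foc[OF \<open>r \<in> Y\<close>] by blast
  define w where "w = (p + r) / 2"
  have w: "p < w" "w < r"
    using \<open>p < r\<close> by (simp_all add: w_def)
  then have "w \<in> Y"
    using mem_is_interval_1_I[OF interval_Y \<open>p \<in> Y\<close> \<open>r \<in> Y\<close>] by simp
  \<comment> \<open>The best reply to HR of an agent with the midpoint potential \<open>w\<close>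
    and full weight \<open>c\<close>. Once HP has potential below \<open>w\<close>, its consumption
    is at most \<open>b\<close> for every integration, so its gap is at least \<open>X - b\<close>;
    hence the witness \<open>c * \<Phi> (X - b)\<close> for \<open>\<eta>\<close>.\<close>
  obtain b where b: "0 \<le> b" "ux b w + (c * \<phi> (X - b) + 0 * \<phi> (X - b)) = 0"
    using two_link_solution[OF \<open>w \<in> Y\<close>, of c 0 X X] \<open>0 < c\<close> by auto
  have "b < X"
  proof (rule ccontr)
    assume "\<not> b < X"
    then have "ux b w = 0" "ux b w \<le> ux X w"
      using b(2) ux_strict_antimono[of X b w] X(1) \<open>w \<in> Y\<close> by (cases "b = X"; simp)+
    then show False
      using ux_strict_mono[OF \<open>0 < X\<close> \<open>w \<in> Y\<close> \<open>r \<in> Y\<close> w(2)] X(2) by simp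
  qed
  have "b \<noteq> 0"
  proof
    assume "b = 0"
    moreover have "0 \<le> c * \<phi> (X - b)"
      using \<open>0 < c\<close> \<phi>_nonneg by simp
    ultimately show False
      using b(2) ux_zero_pos[OF \<open>w \<in> Y\<close>] by simp
  qed
  then have "0 < b" using b(1) by simp
  show thesis
  proof
    show "0 < c * \<Phi> (X - b)"
      using \<open>0 < c\<close> \<open>b < X\<close> by (simp add: \<Phi>_pos)
    fix \<epsilon> :: real assume "0 < \<epsilon>"
    obtain \<mu> where \<mu>: "0 < \<mu>"
      and curvature: "\<And>a b e. 0 \<le> a \<Longrightarrow> a \<le> b \<Longrightarrow> b \<le> X \<Longrightarrow> p \<le> e \<Longrightarrow> e \<le> r \<Longrightarrow> \<mu> * (b - a) \<le> ux a e - ux b e"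
      using curvature_bound[of p r X] assms X(1) by (metis less_imp_le)
    \<comment> \<open>The bounds for LR and for LP at a gap \<open>\<tau>\<close>, added up. The sum
      is continuous and vanishes at 0 because \<open>\<Phi>\<close> and \<open>\<phi>\<close>
      do.\<close>
    define g where "g \<tau> = c * \<Phi> \<tau> + c * (\<phi> X * (c * \<phi> \<tau> / \<mu>))" for \<tau>
    have "isCont \<phi> 0"
      using continuous_\<phi> by (simp add: continuous_on_eq_continuous_at)
    then have "isCont g 0"
      unfolding g_def using DERIV_isCont[OF deriv_\<Phi>] \<mu> by (intro continuous_intros) auto
    moreover have "g 0 = 0"
      by (simp add: g_def)
    ultimately obtain k where "0 < k" and k: "\<And>\<tau>. \<bar>\<tau>\<bar> < k \<Longrightarrow> \<bar>g \<tau>\<bar> < \<epsilon>"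
      using \<open>0 < \<epsilon>\<close> unfolding continuous_at_eps_delta by (auto simp: dist_real_def)
    \<comment> \<open>Small enough to keep both gains below \<open>\<epsilon>\<close> and
      \<open>X - \<tau>\<close> positive, and to put \<open>b\<close> below
      \<open>X - \<tau>\<close>, so that HP consumes less than LR.\<close>
    define \<tau> where "\<tau> = min (k / 2) (min (X / 2) ((X - b) / 2))"
    have \<tau>: "0 < \<tau>" "\<tau> < X" "\<tau> < X - b" "\<tau> < k"
      using \<open>0 < k\<close> X(1) \<open>b < X\<close> by (auto simp: \<tau>_def min_def)
    have "0 \<le> c * \<Phi> \<tau>" "0 \<le> c * (\<phi> X * (c * \<phi> \<tau> / \<mu>))"
      using \<open>0 < c\<close> \<Phi>_nonneg \<phi>_nonneg \<mu> by simp_all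
    with k[of \<tau>] \<tau> have small: "c * \<Phi> \<tau> \<le> \<epsilon>" "c * (\<phi> X * (c * \<phi> \<tau> / \<mu>)) \<le> \<epsilon>"
      by (simp_all add: g_def)
    \<comment> \<open>Positive marginal utility at \<open>X - \<tau>\<close> persists for potentials
      near \<open>r\<close>. Since comparison only raises consumption, LR then consumes at least
      \<open>X - \<tau>\<close>.\<close>
    have "0 < ux (X - \<tau>) r"
      using ux_strict_antimono[of "X - \<tau>" X r] \<tau> X \<open>r \<in> Y\<close> by simp
    then obtain k' where "0 < k'" and k': "\<And>e. r - k' < e \<Longrightarrow> e < r \<Longrightarrow> 0 < ux (X - \<tau>) e"
      using ux_pos_near[of "X - \<tau>" r] \<tau> \<open>r \<in> Y\<close> by (metis diff_ge_0_iff_ge less_imp_le)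
    \<comment> \<open>The bound \<open>k'\<close> keeps LR close to HR; the bound
      \<open>(r - p) / 2\<close> keeps the potential of HP below the midpoint
      \<open>w\<close>.\<close>
    define \<delta> where "\<delta> = min k' ((r - p) / 2)"
    have "0 < \<delta>"
      using \<open>0 < k'\<close> \<open>p < r\<close> by (simp add: \<delta>_def)
    have \<delta>: "\<delta> \<le> k'" "\<delta> \<le> (r - p) / 2"
      unfolding \<delta>_def by (rule min.cobounded1, rule min.cobounded2)
    have "class_payoff c \<rho>' e x' HP \<le> class_payoff c \<rho> e x HP - (\<rho>' - \<rho>) * (c * \<Phi> (X - b)) \<and>
        class_payoff c \<rho>' e x' LR \<le> class_payoff c \<rho> e x LR + (\<rho>' - \<rho>) * \<epsilon> \<and>
        class_payoff c \<rho>' e x' LP \<le> class_payoff c \<rho> e x LP + (\<rho>' - \<rho>) * \<epsilon>"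
      if e: "ordered_potentials e" "e LP = p" "e HR = r" "e HP < p + \<delta>" "r - \<delta> < e LR"
        and \<rho>: "0 < \<rho>" "\<rho> < \<rho>'" "\<rho>' < 1"
        and x: "class_equilibrium c \<rho> e x" and x': "class_equilibrium c \<rho>' e x'" for e \<rho> \<rho>' x x'
    proof -
      note compare = class_payoff_comparison[OF e(1) \<open>0 < c\<close> \<rho> x x']
      note Y = ordered_potentials_in_Y[OF e(1)]
      have nonneg: "0 \<le> x q" "0 \<le> x' q" for q
        using x x' unfolding class_equilibrium_def by blast+
      have foc: "ux (x HR) (e HR) = 0"
        "ux (x' HP) (e HP) + c * \<rho>' * \<phi> (x' HR - x' HP) = 0"
        "ux (x' LR) (e LR) + c * (1 - \<rho>') * \<phi> (x' HR - x' LR) = 0"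
        using x x' unfolding class_equilibrium_def by blast+
      have HR: "x HR = X"
        using ux_strict_antimono[OF nonneg(1)[of HR] _ \<open>r \<in> Y\<close>, of X] foc(1) e(3)
          ux_strict_antimono[of X "x HR" r] X \<open>r \<in> Y\<close>
        by (cases "x HR" X rule: linorder_cases) auto
      have e_order: "p < e HP" "p < e LR" "e LR < r"
        using e(1-3) unfolding ordered_potentials_def by simp_all
      have "e HP < w"
        using e(4) \<delta>(2) by (simp add: w_def field_simps)
      have LR: "X - \<tau> \<le> x' LR"
      proof (rule ccontr)
        assume "\<not> X - \<tau> \<le> x' LR"
        then have "ux (X - \<tau>) (e LR) < ux (x' LR) (e LR)"
          using ux_strict_antimono[OF nonneg(2) _ Y, of LR "X - \<tau>" LR] by simp
        moreover have "0 < ux (X - \<tau>) (e LR)"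
          using k'[of "e LR"] e(5) e_order(3) \<delta>(1) by simp
        moreover have "0 \<le> c * (1 - \<rho>') * \<phi> (x' HR - x' LR)"
          using \<open>0 < c\<close> \<rho> \<phi>_nonneg by simp
        ultimately show False
          using foc(3) by linarith
      qed
      have HP: "x' HP \<le> b"
      proof (rule ccontr)
        assume "\<not> x' HP \<le> b"
        have "c * \<rho>' * \<phi> (X - x' HP) \<le> c * 1 * \<phi> (X - b)"
          using \<open>\<not> x' HP \<le> b\<close> \<open>0 < c\<close> \<rho> \<phi>_nonneg by (intro mult_mono mono_\<phi>) auto
        then have "ux (x' HP) (e HP) + c * \<rho>' * \<phi> (X - x' HP) < ux b (e HP) + c * 1 * \<phi> (X - b)"
          using \<open>\<not> x' HP \<le> b\<close> b(1) by (intro foc_strict_antimono Y) auto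
        moreover have "ux b (e HP) < ux b w"
          using ux_strict_mono[OF \<open>0 < b\<close> Y \<open>w \<in> Y\<close> \<open>e HP < w\<close>] .
        ultimately show False
          using foc(2) b(2) compare(1) HR by simp
      qed
      have "(\<rho>' - \<rho>) * (c * \<Phi> (X - b)) \<le> (\<rho>' - \<rho>) * (c * \<Phi> (x HR - x' HP))"
        using \<rho> \<open>0 < c\<close> HP HR by (intro mult_left_mono mono_\<Phi>) auto
      moreover have "(\<rho>' - \<rho>) * (c * \<Phi> (x HR - x' LR)) \<le> (\<rho>' - \<rho>) * \<epsilon>"
      proof (rule mult_left_mono)
        have "c * \<Phi> (x HR - x' LR) \<le> c * \<Phi> \<tau>"
          using \<open>0 < c\<close> LR HR by (intro mult_left_mono mono_\<Phi>) auto
        with small(1) show "c * \<Phi> (x HR - x' LR) \<le> \<epsilon>" by simp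
      qed (use \<rho> in simp)
      moreover have "class_payoff c \<rho>' e x' LP \<le> class_payoff c \<rho> e x LP
          + (\<rho>' - \<rho>) * (c * (\<phi> (x HR) * (c * \<phi> (x HR - x' LR) / \<mu>)))"
        by (rule compare(4)[OF \<mu>]) (use curvature e_order HR HP LR \<tau> in auto)
      moreover have "(\<rho>' - \<rho>) * (c * (\<phi> (x HR) * (c * \<phi> (x HR - x' LR) / \<mu>))) \<le> (\<rho>' - \<rho>) * \<epsilon>"
      proof (rule mult_left_mono)
        have "c * (\<phi> X * (c * \<phi> (X - x' LR) / \<mu>)) \<le> c * (\<phi> X * (c * \<phi> \<tau> / \<mu>))"
          using \<open>0 < c\<close> \<mu> LR \<phi>_nonneg by (intro mult_left_mono divide_right_mono mono_\<phi>) auto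
        with small(2) HR show "c * (\<phi> (x HR) * (c * \<phi> (x HR - x' LR) / \<mu>)) \<le> \<epsilon>" by simp
      qed (use \<rho> in simp)
      ultimately show ?thesis
        using compare(2,3) by linarith
    qed
    with \<open>0 < \<delta>\<close> show "\<exists>\<delta>>0. \<forall>e \<rho> \<rho>' x x'.
      ordered_potentials e \<and> e LP = p \<and> e HR = r \<and> e HP < p + \<delta> \<and> r - \<delta> < e LR \<and>
      0 < \<rho> \<and> \<rho> < \<rho>' \<and> \<rho>' < 1 \<and> class_equilibrium c \<rho> e x \<and> class_equilibrium c \<rho>' e x' \<longrightarrow>
      class_payoff c \<rho>' e x' HP \<le> class_payoff c \<rho> e x HP - (\<rho>' - \<rho>) * (c * \<Phi> (X - b)) \<and>
      class_payoff c \<rho>' e x' LR \<le> class_payoff c \<rho> e x LR + (\<rho>' - \<rho>) * \<epsilon> \<and>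
      class_payoff c \<rho>' e x' LP \<le> class_payoff c \<rho> e x LP + (\<rho>' - \<rho>) * \<epsilon>"
      by (intro exI[of _ \<delta>]) (simp del: class_payoff.simps)
  qed
qed

section \<open>Welfare when LR is close to HR and HP is close to LP in potential\<close>

lemma welfare_decreasing:
  fixes cls :: "'n::finite \<Rightarrow> agent_class" and W :: "real^'n \<Rightarrow> real"
  assumes pr: "p \<in> Y" "r \<in> Y" "p < r" and net: "0 < d" "0 < \<omega>" "\<omega> < 1"
    and cls: "equal_classes cls" and W: "C1_welfare W" "bounded_partials W"
  obtains \<delta> where "0 < \<delta>"
    and "\<And>e \<rho> \<rho>' G G'. \<lbrakk>ordered_potentials e; e LP = p; e HR = r; e HP < p + \<delta>; r - \<delta> < e LR;
      0 < \<rho>; \<rho> < \<rho>'; \<rho>' < 1; network cls d \<omega> \<rho> G; network cls d \<omega> \<rho>' G'\<rbrakk> \<Longrightarrow>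
      W (equilibrium_payoffs u F (\<lambda>i. e (cls i)) G') < W (equilibrium_payoffs u F (\<lambda>i. e (cls i)) G)"
proof -
  define c where "c = d * (1 - \<omega>)"
  have "0 < c"
    using net by (simp add: c_def)
  obtain m M where m: "0 < m" "m \<le> M"
    and partials: "\<And>i U. m \<le> partial_W W i U" "\<And>i U. partial_W W i U \<le> M"
    using W(2) unfolding bounded_partials_def by blast
  obtain \<eta> where "0 < \<eta>"
    and estimates: "\<And>\<epsilon>. 0 < \<epsilon> \<Longrightarrow> \<exists>\<delta>>0. \<forall>e \<rho> \<rho>' x x'.
      ordered_potentials e \<and> e LP = p \<and> e HR = r \<and> e HP < p + \<delta> \<and> r - \<delta> < e LR \<and>
      0 < \<rho> \<and> \<rho> < \<rho>' \<and> \<rho>' < 1 \<and> class_equilibrium c \<rho> e x \<and> class_equilibrium c \<rho>' e x' \<longrightarrow>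
      class_payoff c \<rho>' e x' HP \<le> class_payoff c \<rho> e x HP - (\<rho>' - \<rho>) * \<eta> \<and>
      class_payoff c \<rho>' e x' LR \<le> class_payoff c \<rho> e x LR + (\<rho>' - \<rho>) * \<epsilon> \<and>
      class_payoff c \<rho>' e x' LP \<le> class_payoff c \<rho> e x LP + (\<rho>' - \<rho>) * \<epsilon>"
    by (rule class_payoff_estimates[OF pr \<open>0 < c\<close>]) blast
  \<comment> \<open>Makes \<open>2 * M * \<epsilon>\<close> equal to \<open>m * \<eta> / 2\<close>,
    so the weighted gains stay strictly below the weighted loss.\<close>
  define \<epsilon> where "\<epsilon> = m * \<eta> / (4 * M)"
  have "0 < \<epsilon>"
    using m \<open>0 < \<eta>\<close> by (simp add: \<epsilon>_def)
  obtain \<delta> where "0 < \<delta>" and \<delta>: "\<forall>e \<rho> \<rho>' x x'.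
      ordered_potentials e \<and> e LP = p \<and> e HR = r \<and> e HP < p + \<delta> \<and> r - \<delta> < e LR \<and>
      0 < \<rho> \<and> \<rho> < \<rho>' \<and> \<rho>' < 1 \<and> class_equilibrium c \<rho> e x \<and> class_equilibrium c \<rho>' e x' \<longrightarrow>
      class_payoff c \<rho>' e x' HP \<le> class_payoff c \<rho> e x HP - (\<rho>' - \<rho>) * \<eta> \<and>
      class_payoff c \<rho>' e x' LR \<le> class_payoff c \<rho> e x LR + (\<rho>' - \<rho>) * \<epsilon> \<and>
      class_payoff c \<rho>' e x' LP \<le> class_payoff c \<rho> e x LP + (\<rho>' - \<rho>) * \<epsilon>"
    using estimates[OF \<open>0 < \<epsilon>\<close>] by (elim exE conjE)
  show thesis
  proof (rule that[OF \<open>0 < \<delta>\<close>])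
    fix e \<rho> \<rho>' and G G' :: "real^'n^'n"
    assume e: "ordered_potentials e" "e LP = p" "e HR = r" "e HP < p + \<delta>" "r - \<delta> < e LR"
      and \<rho>: "0 < \<rho>" "\<rho> < \<rho>'" "\<rho>' < 1" and G: "network cls d \<omega> \<rho> G" and G': "network cls d \<omega> \<rho>' G'"
    have "\<rho> < 1" "0 < \<rho>'"
      using \<rho> by simp_all
    obtain x where x: "class_equilibrium c \<rho> e x"
      and U: "\<And>i. equilibrium_payoffs u F (\<lambda>i. e (cls i)) G $ i = class_payoff c \<rho> e x (cls i)"
      using equilibrium_payoffs_by_class[OF e(1) net \<rho>(1) \<open>\<rho> < 1\<close> G] unfolding c_def by blast
    obtain x' where x': "class_equilibrium c \<rho>' e x'"
      and U': "\<And>i. equilibrium_payoffs u F (\<lambda>i. e (cls i)) G' $ i = class_payoff c \<rho>' e x' (cls i)"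
      using equilibrium_payoffs_by_class[OF e(1) net \<open>0 < \<rho>'\<close> \<rho>(3) G'] unfolding c_def by blast
    have HR: "class_payoff c \<rho>' e x' HR = class_payoff c \<rho> e x HR"
      using class_payoff_comparison(1)[OF e(1) \<open>0 < c\<close> \<rho> x x'] by simp
    have change: "class_payoff c \<rho>' e x' HP \<le> class_payoff c \<rho> e x HP - (\<rho>' - \<rho>) * \<eta>"
      "class_payoff c \<rho>' e x' LR \<le> class_payoff c \<rho> e x LR + (\<rho>' - \<rho>) * \<epsilon>"
      "class_payoff c \<rho>' e x' LP \<le> class_payoff c \<rho> e x LP + (\<rho>' - \<rho>) * \<epsilon>"
      using \<delta>[rule_format, of e \<rho> \<rho>' x x'] e \<rho> x x' by blast+
    have "2 * M * \<epsilon> < m * \<eta>"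
      using m \<open>0 < \<eta>\<close> by (simp add: \<epsilon>_def)
    then have "(\<rho>' - \<rho>) * (2 * M * \<epsilon>) < (\<rho>' - \<rho>) * (m * \<eta>)"
      using \<rho> by (intro mult_strict_left_mono) auto
    then have gain: "2 * M * ((\<rho>' - \<rho>) * \<epsilon>) < m * ((\<rho>' - \<rho>) * \<eta>)"
      by (simp only: mult.left_commute mult.assoc)
    show "W (equilibrium_payoffs u F (\<lambda>i. e (cls i)) G') < W (equilibrium_payoffs u F (\<lambda>i. e (cls i)) G)"
    proof (rule welfare_decreases[OF W(1) cls m(1) partials _ gain])
      show "0 \<le> (\<rho>' - \<rho>) * \<epsilon>"
        using \<rho> \<open>0 < \<epsilon>\<close> by simp
      fix i
      show "cls i = HR \<Longrightarrow> equilibrium_payoffs u F (\<lambda>i. e (cls i)) G' $ i = equilibrium_payoffs u F (\<lambda>i. e (cls i)) G $ i"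
        unfolding U U' using HR by simp
      show "cls i = HP \<Longrightarrow> equilibrium_payoffs u F (\<lambda>i. e (cls i)) G' $ i
          \<le> equilibrium_payoffs u F (\<lambda>i. e (cls i)) G $ i - (\<rho>' - \<rho>) * \<eta>"
        unfolding U U' using change(1) by (simp only:)
      show "cls i = LR \<or> cls i = LP \<Longrightarrow> equilibrium_payoffs u F (\<lambda>i. e (cls i)) G' $ i
          \<le> equilibrium_payoffs u F (\<lambda>i. e (cls i)) G $ i + (\<rho>' - \<rho>) * \<epsilon>"
        unfolding U U' using change(2,3) by (elim disjE) (simp_all only:)
    qed
  qed
qed

end

section \<open>Symmetry between ability and background\<close>

fun swap_class :: "agent_class \<Rightarrow> agent_class" where
  "swap_class (High, Rich) = HR"
| "swap_class (High, Poor) = LR"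
| "swap_class (Low, Rich) = HP"
| "swap_class (Low, Poor) = LP"

lemma swap_class_swap_class [simp]: "swap_class (swap_class q) = q"
  by (cases q rule: agent_class_cases) simp_all

lemma swap_class_eq_iff: "swap_class q = q' \<longleftrightarrow> q = swap_class q'"
  by auto

text \<open>Exchanging HP and LR turns links of equal ability into links of equal background and
  conversely, which is the exchange of \<open>\<rho>\<close> and \<open>1 - \<rho>\<close>.\<close>

lemma link_share_swap_class: "link_share \<omega> (1 - \<rho>) (swap_class q) q' = link_share \<omega> \<rho> q (swap_class q')"
  by (cases q rule: agent_class_cases; cases q' rule: agent_class_cases) (simp_all add: link_share_def)

lemma network_swap_class:
  assumes "network cls d \<omega> \<rho> G"
  shows "network (\<lambda>i. swap_class (cls i)) d \<omega> (1 - \<rho>) G"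
  using assms unfolding network_def swap_class_eq_iff link_share_swap_class by blast

lemma equal_classes_swap_class:
  "equal_classes cls \<Longrightarrow> equal_classes (\<lambda>i. swap_class (cls i))"
  unfolding equal_classes_def swap_class_eq_iff by blast

section \<open>Earning potentials near the ends of the mobility range\<close>

lemma tendsto_zero_at_right_zero_less:
  fixes f :: "real \<Rightarrow> real"
  assumes "(f \<longlongrightarrow> 0) (at_right 0)" "0 < \<delta>"
  obtains b where "0 < b" "\<And>s. 0 < s \<Longrightarrow> s < b \<Longrightarrow> f s < \<delta>"
  using order_tendstoD(2)[OF assms] unfolding eventually_at_right_field by blast

lemma tendsto_zero_at_left_one_less:
  fixes f :: "real \<Rightarrow> real"
  assumes "(f \<longlongrightarrow> 0) (at_left 1)" "0 < \<delta>"
  obtains b where "b < 1" "\<And>s. b < s \<Longrightarrow> s < 1 \<Longrightarrow> f s < \<delta>"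
  using order_tendstoD(2)[OF assms] unfolding eventually_at_left_field by blast

text \<open>The derivatives vanish on the open interval. Fixed extreme potentials allow
  \<open>\<delta>\<close> to be chosen before the mobility \<open>s\<close>.\<close>

lemma earning_potential_extremes_constant:
  assumes "earning_potential y"
  obtains p r where "\<And>s. s \<in> {0<..<1} \<Longrightarrow> y Low Poor s = p" "\<And>s. s \<in> {0<..<1} \<Longrightarrow> y High Rich s = r"
proof -
  have const: "y a b s = y a b (1 / 2)"
    if zero: "\<And>s. s \<in> {0<..<1} \<Longrightarrow> deriv (y a b) s = 0" and "s \<in> {0<..<1}" for a b s
  proof (rule DERIV_isconst3[where f = "y a b" and a = 0 and b = 1])
    fix t :: real assume "t \<in> {0<..<1}"
    moreover from this have "y a b differentiable (at t)"
      using assms unfolding earning_potential_def by blast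
    ultimately show "DERIV (y a b) t :> 0"
      using zero by (metis DERIV_deriv_iff_real_differentiable)
  qed (use that in auto)
  show thesis
  proof
    show "y Low Poor s = y Low Poor (1 / 2)" "y High Rich s = y High Rich (1 / 2)"
      if "s \<in> {0<..<1}" for s
      using assms that unfolding earning_potential_def by (intro const; blast)+
  qed
qed

section \<open>Integration and welfare at low and at high mobility\<close>

theorem proposition3:
  fixes cls :: "'n::finite \<Rightarrow> agent_class"
    and y :: "ability \<Rightarrow> background \<Rightarrow> real \<Rightarrow> real"
    and d \<omega> :: real
    and Y :: "real set"
    and u :: "real \<Rightarrow> real \<Rightarrow> real"
    and F :: "real \<Rightarrow> real"
    and W :: "real^'n \<Rightarrow> real"
  assumes "equal_classes cls"
    and "earning_potential y"
    and "d > 0" and "0 < \<omega>" and "\<omega> < 1"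
    and "open Y" and "is_interval Y"
    and "\<forall>s\<in>{0..1}. {y Low Poor s..y High Rich s} \<subseteq> Y"
    and "consumption_utility Y u"
    and "comparison_loss F"
    and "C1_welfare W"
    and "strictly_increasing_welfare W"
    and "bounded_partials W"
    and "weak_pigou_dalton W"
  shows "(\<exists>s0\<in>{0<..<1}. \<forall>s\<in>{0<..<s0}. \<forall>\<rho> \<rho>' G G'.
            0 < \<rho> \<and> \<rho> < \<rho>' \<and> \<rho>' < 1 \<and> network cls d \<omega> \<rho> G \<and> network cls d \<omega> \<rho>' G' \<longrightarrow>
            equilibrium_welfare W u F y cls s G' < equilibrium_welfare W u F y cls s G)
       \<and> (\<exists>s1\<in>{0<..<1}. \<forall>s\<in>{s1<..<1}. \<forall>\<rho> \<rho>' G G'.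
            0 < \<rho> \<and> \<rho> < \<rho>' \<and> \<rho>' < 1 \<and> network cls d \<omega> \<rho> G \<and> network cls d \<omega> \<rho>' G' \<longrightarrow>
            equilibrium_welfare W u F y cls s G < equilibrium_welfare W u F y cls s G')"
proof -
  obtain \<phi> where "\<And>t. ((\<lambda>t. F (max 0 t)) has_real_derivative \<phi> t) (at t)"
    and "continuous_on UNIV \<phi>" and "\<phi> 0 = 0" and "convex_on UNIV (\<lambda>t. F (max 0 t))"
    using comparison_loss_extension[OF assms(10)] by blast
  moreover have F: "F 0 = 0" "strict_mono_on {0..} F"
    using assms(10) by (simp_all add: comparison_loss_def)
  moreover have "0 < F t" if "0 < t" for t
    using strict_mono_onD[OF F(2), of 0 t] F(1) that by simp
  ultimately interpret status_game Y u F \<phi>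
    using assms(6,7,9) by unfold_locales
  obtain p r where p: "\<And>s. s \<in> {0<..<1} \<Longrightarrow> y Low Poor s = p"
    and r: "\<And>s. s \<in> {0<..<1} \<Longrightarrow> y High Rich s = r"
    using earning_potential_extremes_constant[OF assms(2)] by blast
  have order: "y Low b s < y High b s" "y a Poor s < y a Rich s" if "s \<in> {0<..<1}" for a b s
    using assms(2) that unfolding earning_potential_def by blast+
  have bounds: "p < y High Poor s" "y High Poor s < r" "p < y Low Rich s" "y Low Rich s < r"
    if "s \<in> {0<..<1}" for s
    using order[OF that] p[OF that] r[OF that] by metis+
  have "p < r"
    using bounds(1,2)[of "1 / 2"] by simp
  moreover have "{p..r} \<subseteq> Y"
    using assms(8)[rule_format, of "1 / 2"] p[of "1 / 2"] r[of "1 / 2"] by simp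
  ultimately have pr: "p \<in> Y" "r \<in> Y" "p < r"
    by auto
  note decreasing = welfare_decreasing[OF pr assms(3-5) _ assms(11,13)]
  show ?thesis
  proof
    let ?e = "\<lambda>s q. y (fst q) (snd q) s"
    obtain \<delta> where "0 < \<delta>" and \<delta>: "\<And>e \<rho> \<rho>' G G'. \<lbrakk>ordered_potentials e; e LP = p; e HR = r;
        e HP < p + \<delta>; r - \<delta> < e LR; 0 < \<rho>; \<rho> < \<rho>'; \<rho>' < 1; network cls d \<omega> \<rho> G; network cls d \<omega> \<rho>' G'\<rbrakk> \<Longrightarrow>
        W (equilibrium_payoffs u F (\<lambda>i. e (cls i)) G') < W (equilibrium_payoffs u F (\<lambda>i. e (cls i)) G)"
      using decreasing[OF assms(1)] by blast
    have lim: "((\<lambda>s. y High b s - y Low b s) \<longlongrightarrow> 0) (at_right 0)" for b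
      using assms(2) unfolding earning_potential_def by blast
    obtain b where b: "0 < b" "\<And>s. 0 < s \<Longrightarrow> s < b \<Longrightarrow> y High Rich s - y Low Rich s < \<delta>"
      using tendsto_zero_at_right_zero_less[OF lim \<open>0 < \<delta>\<close>] by blast
    obtain b' where b': "0 < b'" "\<And>s. 0 < s \<Longrightarrow> s < b' \<Longrightarrow> y High Poor s - y Low Poor s < \<delta>"
      using tendsto_zero_at_right_zero_less[OF lim \<open>0 < \<delta>\<close>] by blast
    \<comment> \<open>Below \<open>b\<close> the potential of LR is within \<open>\<delta>\<close>
      of \<open>r\<close>, below \<open>b'\<close> that of HP is within \<open>\<delta>\<close> of
      \<open>p\<close>; the cap \<open>1 / 2\<close> keeps \<open>s0\<close> inside the unit
      interval.\<close>
    define s0 where "s0 = min (1 / 2) (min b b')"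
    have "W (equilibrium_payoffs u F (\<lambda>i. ?e s (cls i)) G') < W (equilibrium_payoffs u F (\<lambda>i. ?e s (cls i)) G)"
      if s: "s \<in> {0<..<s0}" and net: "0 < \<rho>" "\<rho> < \<rho>'" "\<rho>' < 1" "network cls d \<omega> \<rho> G" "network cls d \<omega> \<rho>' G'"
      for s \<rho> \<rho>' G G'
    proof (rule \<delta>[OF _ _ _ _ _ net])
      have s': "s \<in> {0<..<1}" "s < b" "s < b'"
        using s by (auto simp: s0_def)
      show "ordered_potentials (?e s)" "?e s LP = p" "?e s HR = r"
        using bounds[OF s'(1)] p[OF s'(1)] r[OF s'(1)] pr by (simp_all add: ordered_potentials_def)
      show "?e s HP < p + \<delta>" "r - \<delta> < ?e s LR"
        using b(2)[of s] b'(2)[of s] s' p[OF s'(1)] r[OF s'(1)] by simp_all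
    qed
    then show "\<exists>s0\<in>{0<..<1}. \<forall>s\<in>{0<..<s0}. \<forall>\<rho> \<rho>' G G'.
        0 < \<rho> \<and> \<rho> < \<rho>' \<and> \<rho>' < 1 \<and> network cls d \<omega> \<rho> G \<and> network cls d \<omega> \<rho>' G' \<longrightarrow>
        equilibrium_welfare W u F y cls s G' < equilibrium_welfare W u F y cls s G"
      unfolding equilibrium_welfare_def
      by (intro bexI[of _ s0]) (use b(1) b'(1) in \<open>auto simp: s0_def\<close>)
  next
    \<comment> \<open>Near mobility 1 the potential of HP approaches that of HR and the potential of
      LR that of LP. After exchanging HP and LR this is the situation of low mobility.\<close>
    let ?e = "\<lambda>s q. y (fst (swap_class q)) (snd (swap_class q)) s"
    let ?cls = "\<lambda>i. swap_class (cls i)"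
    obtain \<delta> where "0 < \<delta>" and \<delta>: "\<And>e \<rho> \<rho>' G G'. \<lbrakk>ordered_potentials e; e LP = p; e HR = r;
        e HP < p + \<delta>; r - \<delta> < e LR; 0 < \<rho>; \<rho> < \<rho>'; \<rho>' < 1; network ?cls d \<omega> \<rho> G; network ?cls d \<omega> \<rho>' G'\<rbrakk> \<Longrightarrow>
        W (equilibrium_payoffs u F (\<lambda>i. e (?cls i)) G') < W (equilibrium_payoffs u F (\<lambda>i. e (?cls i)) G)"
      using decreasing[OF equal_classes_swap_class[OF assms(1)]] by blast
    have lim: "((\<lambda>s. y a Rich s - y a Poor s) \<longlongrightarrow> 0) (at_left 1)" for a
      using assms(2) unfolding earning_potential_def by blast
    obtain b where b: "b < 1" "\<And>s. b < s \<Longrightarrow> s < 1 \<Longrightarrow> y High Rich s - y High Poor s < \<delta>"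
      using tendsto_zero_at_left_one_less[OF lim \<open>0 < \<delta>\<close>] by blast
    obtain b' where b': "b' < 1" "\<And>s. b' < s \<Longrightarrow> s < 1 \<Longrightarrow> y Low Rich s - y Low Poor s < \<delta>"
      using tendsto_zero_at_left_one_less[OF lim \<open>0 < \<delta>\<close>] by blast
    define s1 where "s1 = max (1 / 2) (max b b')"
    have "W (equilibrium_payoffs u F (\<lambda>i. y (fst (cls i)) (snd (cls i)) s) G) < W (equilibrium_payoffs u F (\<lambda>i. y (fst (cls i)) (snd (cls i)) s) G')"
      if s: "s \<in> {s1<..<1}" and \<rho>: "0 < \<rho>" "\<rho> < \<rho>'" "\<rho>' < 1" and net: "network cls d \<omega> \<rho> G" "network cls d \<omega> \<rho>' G'"
      for s \<rho> \<rho>' G G'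
    proof -
      have s': "s \<in> {0<..<1}" "b < s" "b' < s"
        using s by (auto simp: s1_def)
      have "W (equilibrium_payoffs u F (\<lambda>i. ?e s (?cls i)) G) < W (equilibrium_payoffs u F (\<lambda>i. ?e s (?cls i)) G')"
      \<comment> \<open>The exchanged networks have integration
        \<open>1 - \<rho>' < 1 - \<rho>\<close>, so they enter in reverse order and the decrease
        becomes an increase.\<close>
      proof (rule \<delta>[OF _ _ _ _ _ _ _ _ network_swap_class[OF net(2)] network_swap_class[OF net(1)]])
        show "ordered_potentials (?e s)" "?e s LP = p" "?e s HR = r"
          using bounds[OF s'(1)] p[OF s'(1)] r[OF s'(1)] pr by (simp_all add: ordered_potentials_def)
        show "?e s HP < p + \<delta>" "r - \<delta> < ?e s LR"
          using b(2)[of s] b'(2)[of s] s' p[OF s'(1)] r[OF s'(1)] by simp_all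
      qed (use \<rho> in simp_all)
      then show ?thesis
        by (simp only: swap_class_swap_class)
    qed
    then show "\<exists>s1\<in>{0<..<1}. \<forall>s\<in>{s1<..<1}. \<forall>\<rho> \<rho>' G G'.
        0 < \<rho> \<and> \<rho> < \<rho>' \<and> \<rho>' < 1 \<and> network cls d \<omega> \<rho> G \<and> network cls d \<omega> \<rho>' G' \<longrightarrow>
        equilibrium_welfare W u F y cls s G < equilibrium_welfare W u F y cls s G'"
      unfolding equilibrium_welfare_def
      by (intro bexI[of _ s1]) (use b(1) b'(1) in \<open>auto simp: s1_def\<close>)
  qed
qed

end
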